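(* Let $S$ be a cancellative right amenable monoid, let $A$ be a torsion abelian group, and let $S \overset{\alpha}{\curvearrowright} A$ be a left action by group endomorphisms. Let $B$ be an $\alpha$-invariant subgroup of $A$, and denote by $\alpha_B$ and $\alpha_{A/B}$ the induced actions of $S$ on $B$ and on $A/B$, respectively. Then $$\mathrm{ent}(\alpha)=\mathrm{ent}(\alpha_B)+\mathrm{ent}(\alpha_{A/B}).$$
   Context: A semigroup $S$ is cancellative if all left and all right multiplications of $S$ are injective. $S$ is right amenable if there is a finitely additive $\mu:\mathcal P(S)\to[0,1]$ with $\mu(S)=1$ and $\mu(R_s^{-1}(F))=\mu(F)$ for all $s\in S$, $F\subseteq S$, where $R_s(x)=xs$. A right Følner net of $S$ is a net $(F_i)_{i\in I}$ of non-empty finite subsets of $S$ with $\lim_{i\in I}|F_is\setminus F_i|/|F_i|=0$ for every $s\in S$ (such nets exist when $S$ is cancellative right amenable). A left action $S\overset{\alpha}{\curvearrowright}A$ on an abelian group $A$ assigns to each $s\in S$ an endomorphism $\alpha(s)$ of $A$ with $\alpha(st)=\alpha(s)\circ\alpha(t)$ for all $s,t\in S$; if $S$ is a monoid, also $\alpha(1)=\mathrm{id}_A$. A subgroup $B\le A$ is $\alpha$-invariant if $\alpha(s)(B)\subseteq B$ for all $s\in S$; then $\alpha_B(s)=\alpha(s)|_B$ and $\alpha_{A/B}(s)(a+B)=\alpha(s)(a)+B$. For non-empty finite $X\subseteq A$ and non-empty finite $F\subseteq S$ put $T_F(\alpha,X)=\sum_{s\in F}\alpha(s)(X)$ (sum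 of subsets). Set $H_{alg}(\alpha,X)=\lim_{i\in I}\frac{\log|T_{F_i}(\alpha,X)|}{|F_i|}$, where $(F_i)_{i\in I}$ is any right Følner net of $S$; the limit is known to exist, to be finite, and not to depend on the chosen net. Define $\mathrm{ent}(\alpha)=\sup\{H_{alg}(\alpha,X): X \text{ a finite subgroup of } A\}\in[0,\infty]$. *)

theory Defs
  imports "HOL-Algebra.Coset" "HOL-Algebra.FiniteProduct" "HOL-Algebra.Divisibility" "HOL-Library.Extended_Real" Complex_Main
begin

text \<open>
  Abelian groups are written multiplicatively, as \<^locale>\<open>comm_group\<close> in HOL-Algebra, so
  that subgroups and the quotient \<open>A Mod B\<close> are available. The cancellative monoid acting is
  an instance of \<^locale>\<open>monoid_cancel\<close>.
\<close>

definition right_amenable :: "('s, 'm) monoid_scheme \<Rightarrow> bool" where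
  "right_amenable S \<longleftrightarrow>
     (\<exists>\<mu> :: 's set \<Rightarrow> real.
        (\<forall>E. E \<subseteq> carrier S \<longrightarrow> 0 \<le> \<mu> E \<and> \<mu> E \<le> 1) \<and>
        (\<forall>D E. D \<subseteq> carrier S \<longrightarrow> E \<subseteq> carrier S \<longrightarrow> D \<inter> E = {} \<longrightarrow> \<mu> (D \<union> E) = \<mu> D + \<mu> E) \<and>
        \<mu> (carrier S) = 1 \<and>
        (\<forall>s\<in>carrier S. \<forall>E. E \<subseteq> carrier S \<longrightarrow> \<mu> {x \<in> carrier S. x \<otimes>\<^bsub>S\<^esub> s \<in> E} = \<mu> E))"

subsection \<open>Nets and right Folner nets\<close>

definition directed_set :: "'i set \<Rightarrow> ('i \<Rightarrow> 'i \<Rightarrow> bool) \<Rightarrow> bool" where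
  "directed_set I leq \<longleftrightarrow>
     I \<noteq> {} \<and>
     (\<forall>i\<in>I. leq i i) \<and>
     (\<forall>i\<in>I. \<forall>j\<in>I. \<forall>k\<in>I. leq i j \<longrightarrow> leq j k \<longrightarrow> leq i k) \<and>
     (\<forall>i\<in>I. \<forall>j\<in>I. \<exists>k\<in>I. leq i k \<and> leq j k)"

definition net_filter :: "'i set \<Rightarrow> ('i \<Rightarrow> 'i \<Rightarrow> bool) \<Rightarrow> 'i filter" where
  "net_filter I leq = (INF i\<in>I. principal {j \<in> I. leq i j})"

lemma eventually_net_filter:
  assumes "directed_set I leq"
  shows "eventually P (net_filter I leq) \<longleftrightarrow> (\<exists>i\<in>I. \<forall>j\<in>I. leq i j \<longrightarrow> P j)"
proof -
  have "\<exists>k\<in>I. principal {j \<in> I. leq k j} \<le> inf (principal {j \<in> I. leq a j}) (principal {j \<in> I. leq b j})"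
    if "a \<in> I" "b \<in> I" for a b
  proof -
    from assms that obtain k where "k \<in> I" "leq a k" "leq b k"
      unfolding directed_set_def by blast
    moreover from this assms that have "leq a j \<and> leq b j" if "j \<in> I" "leq k j" for j
      using that unfolding directed_set_def by blast
    ultimately show ?thesis by auto
  qed
  moreover have "I \<noteq> {}" using assms by (simp add: directed_set_def)
  ultimately show ?thesis
    unfolding net_filter_def
    by (subst eventually_INF_base) (auto simp: eventually_principal)
qed

definition right_Folner_net ::
  "('s, 'm) monoid_scheme \<Rightarrow> 'i set \<Rightarrow> ('i \<Rightarrow> 'i \<Rightarrow> bool) \<Rightarrow> ('i \<Rightarrow> 's set) \<Rightarrow> bool" where
  "right_Folner_net S I leq F \<longleftrightarrow>
     directed_set I leq \<and>
     (\<forall>i\<in>I. F i \<subseteq> carrier S \<and> finite (F i) \<and> F i \<noteq> {}) \<and>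
     (\<forall>s\<in>carrier S.
        ((\<lambda>i. real (card ((F i #>\<^bsub>S\<^esub> s) - F i)) / real (card (F i))) \<longlongrightarrow> 0) (net_filter I leq))"

subsection \<open>Actions\<close>

definition left_action ::
  "('s, 'm) monoid_scheme \<Rightarrow> ('a, 'n) monoid_scheme \<Rightarrow> ('s \<Rightarrow> 'a \<Rightarrow> 'a) \<Rightarrow> bool" where
  "left_action S A \<alpha> \<longleftrightarrow>
     (\<forall>s\<in>carrier S. \<alpha> s \<in> hom A A) \<and>
     (\<forall>s\<in>carrier S. \<forall>t\<in>carrier S. \<forall>a\<in>carrier A. \<alpha> (s \<otimes>\<^bsub>S\<^esub> t) a = \<alpha> s (\<alpha> t a)) \<and>
     (\<forall>a\<in>carrier A. \<alpha> \<one>\<^bsub>S\<^esub> a = a)"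

definition invariant_subgroup ::
  "('s, 'm) monoid_scheme \<Rightarrow> ('a, 'n) monoid_scheme \<Rightarrow> ('s \<Rightarrow> 'a \<Rightarrow> 'a) \<Rightarrow> 'a set \<Rightarrow> bool" where
  "invariant_subgroup S A \<alpha> B \<longleftrightarrow> subgroup B A \<and> (\<forall>s\<in>carrier S. \<alpha> s ` B \<subseteq> B)"

definition restr_action :: "('s \<Rightarrow> 'a \<Rightarrow> 'a) \<Rightarrow> 'a set \<Rightarrow> 's \<Rightarrow> 'a \<Rightarrow> 'a" where
  "restr_action \<alpha> B = (\<lambda>s. restrict (\<alpha> s) B)"

text \<open>The common value of the coset of \<open>\<alpha> s a\<close>, for \<open>a\<close> ranging over the given coset;
  see \<open>quot_action_coset\<close> below.\<close>

definition quot_action ::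
  "('a, 'n) monoid_scheme \<Rightarrow> ('s \<Rightarrow> 'a \<Rightarrow> 'a) \<Rightarrow> 'a set \<Rightarrow> 's \<Rightarrow> 'a set \<Rightarrow> 'a set" where
  "quot_action A \<alpha> B = (\<lambda>s C. the_elem ((\<lambda>a. B #>\<^bsub>A\<^esub> \<alpha> s a) ` C))"

lemma quot_action_coset:
  assumes "comm_group A" "left_action S A \<alpha>" "invariant_subgroup S A \<alpha> B"
    and "s \<in> carrier S" "a \<in> carrier A"
  shows "quot_action A \<alpha> B s (B #>\<^bsub>A\<^esub> a) = B #>\<^bsub>A\<^esub> \<alpha> s a"
proof -
  interpret comm_group A by fact
  have B: "subgroup B A" and hom: "\<alpha> s \<in> hom A A" and inv: "\<alpha> s ` B \<subseteq> B"
    using assms by (auto simp: invariant_subgroup_def left_action_def)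
  note sub = subgroup.subset[OF B]
  have "B #>\<^bsub>A\<^esub> \<alpha> s c = B #>\<^bsub>A\<^esub> \<alpha> s a" if c: "c \<in> B #>\<^bsub>A\<^esub> a" for c
  proof -
    from c obtain b where b: "b \<in> B" "c = b \<otimes>\<^bsub>A\<^esub> a" by (auto simp: r_coset_def)
    have cl: "\<alpha> s b \<in> B" "\<alpha> s b \<in> carrier A" "\<alpha> s a \<in> carrier A"
      using b inv sub hom assms(5) by (auto simp: hom_def)
    have "\<alpha> s c = \<alpha> s b \<otimes>\<^bsub>A\<^esub> \<alpha> s a"
      using b hom sub assms(5) by (auto simp: hom_def)
    moreover have "B #>\<^bsub>A\<^esub> \<alpha> s b = B"
      using cl B by (intro coset_join2)
    ultimately show ?thesis
      using cl sub coset_mult_assoc[of B "\<alpha> s b" "\<alpha> s a"] by simp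
  qed
  moreover have "a \<in> B #>\<^bsub>A\<^esub> a" using B assms(5) by (rule rcos_self[rotated])
  ultimately have "(\<lambda>a. B #>\<^bsub>A\<^esub> \<alpha> s a) ` (B #>\<^bsub>A\<^esub> a) = {B #>\<^bsub>A\<^esub> \<alpha> s a}"
    by blast
  then show ?thesis by (simp add: quot_action_def)
qed

subsection \<open>Algebraic entropy\<close>

text \<open>The sum of the subsets \<open>\<alpha> s ` X\<close>, for \<open>s\<close> in the finite set \<open>F\<close>.\<close>

definition trajectory ::
  "('a, 'n) monoid_scheme \<Rightarrow> ('s \<Rightarrow> 'a \<Rightarrow> 'a) \<Rightarrow> 's set \<Rightarrow> 'a set \<Rightarrow> 'a set" where
  "trajectory A \<alpha> F X = {finprod A y F | y. \<forall>s\<in>F. y s \<in> \<alpha> s ` X}"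

definition traj_rate ::
  "('a, 'n) monoid_scheme \<Rightarrow> ('s \<Rightarrow> 'a \<Rightarrow> 'a) \<Rightarrow> 'a set \<Rightarrow> 's set \<Rightarrow> real" where
  "traj_rate A \<alpha> X F = ln (real (card (trajectory A \<alpha> F X))) / real (card F)"

text \<open>
  The common limit over all right Folner nets. HOL cannot quantify over the index type of a net
  inside a definition; the nets indexed by subsets of \<^typ>\<open>'s set set \<times> 's set\<close> are
  enough, since convergence along them implies convergence along a right Folner net with any
  index type (\<open>tendsto_any_right_Folner_net\<close> below).
\<close>

definition H_alg ::
  "('s, 'm) monoid_scheme \<Rightarrow> ('a, 'n) monoid_scheme \<Rightarrow> ('s \<Rightarrow> 'a \<Rightarrow> 'a) \<Rightarrow> 'a set \<Rightarrow> real" where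
  "H_alg S A \<alpha> X =
     (THE h. \<forall>(I :: ('s set set \<times> 's set) set) leq F.
        right_Folner_net S I leq F \<longrightarrow>
        ((\<lambda>i. traj_rate A \<alpha> X (F i)) \<longlongrightarrow> h) (net_filter I leq))"

lemma tendsto_any_right_Folner_net:
  fixes S :: "('s, 'm) monoid_scheme" and I :: "'i set" and f :: "'s set \<Rightarrow> 'b::topological_space"
  assumes all: "\<And>(J :: ('s set set \<times> 's set) set) leq G.
      right_Folner_net S J leq G \<Longrightarrow> ((\<lambda>j. f (G j)) \<longlongrightarrow> h) (net_filter J leq)"
    and net: "right_Folner_net S I leq F"
  shows "((\<lambda>i. f (F i)) \<longlongrightarrow> h) (net_filter I leq)"
proof -
  define tail where "tail i = F ` {j \<in> I. leq i j}" for i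
  define J where "J = {(tail i, F j) | i j. i \<in> I \<and> j \<in> I \<and> leq i j}"
  define leJ :: "'s set set \<times> 's set \<Rightarrow> 's set set \<times> 's set \<Rightarrow> bool"
    where "leJ p q \<longleftrightarrow> fst q \<subseteq> fst p" for p q
  have dir: "directed_set I leq" using net by (simp add: right_Folner_net_def)
  have refl: "leq i i" if "i \<in> I" for i using dir that by (auto simp: directed_set_def)
  have trans: "leq i k" if "leq i j" "leq j k" "i \<in> I" "j \<in> I" "k \<in> I" for i j k
    using dir that unfolding directed_set_def by blast
  have tail_mono: "tail k \<subseteq> tail i" if "i \<in> I" "k \<in> I" "leq i k" for i k
    using that trans unfolding tail_def by blast
  have tailJ: "(tail i, F i) \<in> J" if "i \<in> I" for i
    using that refl by (auto simp: J_def)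
  have dirJ: "directed_set J leJ"
    unfolding directed_set_def
  proof (intro conjI ballI impI)
    show "J \<noteq> {}" using dir tailJ by (auto simp: directed_set_def)
  next
    fix p q assume "p \<in> J" "q \<in> J"
    then obtain i k where ik: "i \<in> I" "k \<in> I" "fst p = tail i" "fst q = tail k"
      by (auto simp: J_def)
    with dir obtain m where m: "m \<in> I" "leq i m" "leq k m" unfolding directed_set_def by blast
    with ik tail_mono have "leJ p (tail m, F m)" "leJ q (tail m, F m)" by (auto simp: leJ_def)
    with m tailJ show "\<exists>r\<in>J. leJ p r \<and> leJ q r" by blast
  qed (auto simp: leJ_def)
  have ev: "eventually (\<lambda>i. P (F i)) (net_filter I leq) \<longleftrightarrow>
      eventually (\<lambda>p. P (snd p)) (net_filter J leJ)" for P
  proof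
    assume "eventually (\<lambda>i. P (F i)) (net_filter I leq)"
    then obtain i where i: "i \<in> I" "\<And>j. j \<in> I \<Longrightarrow> leq i j \<Longrightarrow> P (F j)"
      by (auto simp: eventually_net_filter[OF dir])
    have "P (snd p)" if "p \<in> J" "leJ (tail i, F i) p" for p
    proof -
      have "snd p \<in> fst p" using that(1) by (auto simp: J_def tail_def)
      with that(2) have "snd p \<in> tail i" by (auto simp: leJ_def)
      with i show ?thesis by (auto simp: tail_def)
    qed
    with tailJ[OF i(1)] show "eventually (\<lambda>p. P (snd p)) (net_filter J leJ)"
      unfolding eventually_net_filter[OF dirJ] by blast
  next
    assume "eventually (\<lambda>p. P (snd p)) (net_filter J leJ)"
    then obtain p where p: "p \<in> J" "\<And>q. q \<in> J \<Longrightarrow> leJ p q \<Longrightarrow> P (snd q)"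
      by (auto simp: eventually_net_filter[OF dirJ])
    then obtain i where i: "i \<in> I" "fst p = tail i" by (auto simp: J_def)
    have "P (F j)" if "j \<in> I" "leq i j" for j
      using p(2)[of "(tail i, F j)"] i that by (auto simp: J_def leJ_def)
    with i(1) show "eventually (\<lambda>i. P (F i)) (net_filter I leq)"
      by (auto simp: eventually_net_filter[OF dir])
  qed
  have tends: "((\<lambda>i. g (F i)) \<longlongrightarrow> l) (net_filter I leq) \<longleftrightarrow>
      ((\<lambda>p. g (snd p)) \<longlongrightarrow> l) (net_filter J leJ)"
    for g :: "'s set \<Rightarrow> 'c::topological_space" and l
    unfolding tendsto_def using ev[of "\<lambda>E. g E \<in> _"] by simp
  have "right_Folner_net S J leJ snd"
    using net dirJ unfolding right_Folner_net_def
    by (subst tends[symmetric]) (auto simp: J_def)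
  from all[OF this] show ?thesis by (simp add: tends)
qed

definition ent ::
  "('s, 'm) monoid_scheme \<Rightarrow> ('a, 'n) monoid_scheme \<Rightarrow> ('s \<Rightarrow> 'a \<Rightarrow> 'a) \<Rightarrow> ereal" where
  "ent S A \<alpha> = (SUP X\<in>{X. subgroup X A \<and> finite X}. ereal (H_alg S A \<alpha> X))"

definition torsion_group :: "('a, 'n) monoid_scheme \<Rightarrow> bool" where
  "torsion_group A \<longleftrightarrow> (\<forall>a\<in>carrier A. \<exists>n::nat. n > 0 \<and> a [^]\<^bsub>A\<^esub> n = \<one>\<^bsub>A\<^esub>)"

end

theory Submission
  imports Defs "HOL-Algebra.Generated_Groups"
begin

text \<open>
  For finite subgroups \<open>X\<close> and \<open>V\<close> the function \<open>E \<mapsto> ln |T\<^sub>E(X) V / V|\<close> is submodular. Covering a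
  Folner set \<open>F\<close> by the translates \<open>s K\<close> with \<open>s \<in> F\<close>, each point of \<open>F\<close> being covered \<open>|K|\<close> times
  up to a small defect, a Shearer-type inequality bounds \<open>ln |T\<^sub>F(X) V / V| / |F|\<close> by
  \<open>ln |T\<^sub>K(X) / Y| / |K|\<close> plus a vanishing error, for every subgroup \<open>Y\<close> of \<open>T\<^sub>K(X)\<close> that \<open>F\<close> maps
  into \<open>V\<close>. With \<open>Y\<close> and \<open>V\<close> trivial, this shows that the entropy of \<open>X\<close> is the infimum over \<open>K\<close>
  of \<open>ln |T\<^sub>K(X)| / |K|\<close>; no quasi-tilings are needed.

  Since \<open>|T\<^sub>K(X)| = |T\<^sub>K(\<pi> X)| |T\<^sub>K(X) \<inter> B|\<close>, the infimum formula gives the inequality \<open>\<ge>\<close> once finite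
  subgroups of \<open>A/B\<close> are lifted to finite subgroups of the torsion group \<open>A\<close>. For \<open>\<le>\<close>, take \<open>K\<close> almost
  optimal for \<open>\<pi> X\<close> and apply the covering bound with \<open>Y = T\<^sub>K(X) \<inter> B\<close> and \<open>V = T\<^sub>F(Y)\<close>.
\<close>

subsection \<open>Systems of distinct representatives\<close>

text \<open>Hall's theorem for an arbitrary family of finite sets, by deletion: remove as many pairs
  from the incidence relation as the Hall condition allows; in a maximal deletion every point keeps
  exactly one partner.\<close>

lemma marriage_inj:
  fixes N :: "'a \<Rightarrow> 'b set"
  assumes fin: "\<And>x. x \<in> I \<Longrightarrow> finite (N x)"
    and hall: "\<And>F. F \<subseteq> I \<Longrightarrow> finite F \<Longrightarrow> card F \<le> card (\<Union>x\<in>F. N x)"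
  shows "\<exists>f. inj_on f I \<and> (\<forall>x\<in>I. f x \<in> N x)"
proof -
  \<comment> \<open>\<open>D\<close> is a set of deleted pairs, and \<open>\<D>\<close> collects the
    deletions after which the Hall condition still holds.\<close>
  define nb where "nb D F = (\<Union>x\<in>F. N x - D `` {x})" for D F
  define \<D> where "\<D> = {D. \<forall>F. F \<subseteq> I \<longrightarrow> finite F \<longrightarrow> card F \<le> card (nb D F)}"
  have "{} \<in> \<D>" using hall by (auto simp: \<D>_def nb_def)
  then have "\<D> \<noteq> {}" by blast
  moreover have "\<Union>C \<in> \<D>" if C: "C \<noteq> {}" "subset.chain \<D> C" for C
    unfolding \<D>_def
  proof (intro CollectI allI impI)
    fix F assume F: "F \<subseteq> I" "finite F"
    \<comment> \<open>Only the finitely many pairs over \<open>F\<close> influence \<open>nb\<close>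
      at \<open>F\<close>, so a single member of the chain already deletes all of them that the
      union deletes.\<close>
    have "finite (Sigma F N \<inter> \<Union>C)" using F fin by blast
    then obtain D where D: "D \<in> C" "Sigma F N \<inter> \<Union>C \<subseteq> D"
      using finite_subset_Union_chain[OF _ _ C] by (metis inf_le2)
    then have "nb (\<Union>C) F = nb D F" unfolding nb_def by blast
    moreover have "D \<in> \<D>" using D C by (auto simp: subset.chain_def)
    ultimately show "card F \<le> card (nb (\<Union>C) F)" using F by (simp add: \<D>_def)
  qed
  ultimately obtain M where M: "M \<in> \<D>" and max: "\<And>D. D \<in> \<D> \<Longrightarrow> M \<subseteq> D \<Longrightarrow> D = M"
    using subset_Zorn_nonempty[of \<D>] by blast
  define R where "R x = N x - M `` {x}" for x
  have finR: "finite (R x)" if "x \<in> I" for x using fin[OF that] by (simp add: R_def)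
  have finRU: "finite (\<Union>x\<in>F. R x)" if "F \<subseteq> I" "finite F" for F using that finR by blast
  have hallR: "card F \<le> card (\<Union>x\<in>F. R x)" if "F \<subseteq> I" "finite F" for F
    using M that by (simp add: \<D>_def nb_def R_def)
  \<comment> \<open>By maximality, deleting one more pair (x, y) breaks the Hall condition at some
    finite \<open>F\<close>. This \<open>F\<close> must contain \<open>x\<close>, and
    \<open>G\<close> is \<open>F\<close> without \<open>x\<close>.\<close>
  have crit: "\<exists>G. G \<subseteq> I \<and> finite G \<and> x \<notin> G \<and> card ((\<Union>z\<in>G. R z) \<union> (R x - {y})) \<le> card G"
    if x: "x \<in> I" and y: "y \<in> R x" for x y
  proof -
    have "insert (x, y) M \<noteq> M" using y by (auto simp: R_def)
    with max have "insert (x, y) M \<notin> \<D>" by blast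
    then obtain F where F: "F \<subseteq> I" "finite F" "card (nb (insert (x, y) M) F) < card F"
      by (auto simp: \<D>_def not_le)
    have "x \<in> F"
    proof (rule ccontr)
      assume "x \<notin> F"
      then have "nb (insert (x, y) M) F = (\<Union>z\<in>F. R z)" by (auto simp: nb_def R_def)
      with F(3) hallR[OF F(1,2)] show False by simp
    qed
    moreover from this have "nb (insert (x, y) M) F = (\<Union>z\<in>F - {x}. R z) \<union> (R x - {y})"
      by (auto simp: nb_def R_def)
    ultimately show ?thesis
      using F by (intro exI[of _ "F - {x}"]) (auto simp: card_Diff_singleton)
  qed
  have uniq: "y1 = y2" if x: "x \<in> I" and y: "y1 \<in> R x" "y2 \<in> R x" for x y1 y2
  proof (rule ccontr)
    assume ne: "y1 \<noteq> y2"
    obtain G1 where G1: "G1 \<subseteq> I" "finite G1" "x \<notin> G1"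
      and c1: "card ((\<Union>z\<in>G1. R z) \<union> (R x - {y1})) \<le> card G1" using crit x y by blast
    obtain G2 where G2: "G2 \<subseteq> I" "finite G2" "x \<notin> G2"
      and c2: "card ((\<Union>z\<in>G2. R z) \<union> (R x - {y2})) \<le> card G2" using crit x y by blast
    let ?U1 = "(\<Union>z\<in>G1. R z) \<union> (R x - {y1})" and ?U2 = "(\<Union>z\<in>G2. R z) \<union> (R x - {y2})"
    have fU: "finite ?U1" "finite ?U2" using finRU G1 G2 finR x by blast+
    \<comment> \<open>Since \<open>y1\<close> and \<open>y2\<close> differ, the two punctured copies
      of \<open>R x\<close> cover \<open>R x\<close>. Adding the Hall bounds for the union with
      \<open>x\<close> and for the intersection gives |G1| + |G2| + 1 \<le> |U1| + |U2| \<le> |G1| +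
      |G2|.\<close>
    have "card (insert x (G1 \<union> G2)) \<le> card (\<Union>z\<in>insert x (G1 \<union> G2). R z)"
      using G1 G2 x by (intro hallR) auto
    also have "\<dots> \<le> card (?U1 \<union> ?U2)"
      using fU ne by (intro card_mono) auto
    finally have u: "Suc (card (G1 \<union> G2)) \<le> card (?U1 \<union> ?U2)" using G1 G2 by simp
    have "card (G1 \<inter> G2) \<le> card (\<Union>z\<in>G1 \<inter> G2. R z)" using G1 G2 by (intro hallR) auto
    also have "\<dots> \<le> card (?U1 \<inter> ?U2)" using fU by (intro card_mono) auto
    finally show False
      using u c1 c2 card_Un_Int[OF fU] card_Un_Int[OF G1(2) G2(2)] by linarith
  qed
  have "R x \<noteq> {}" if "x \<in> I" for x using hallR[of "{x}"] that by auto
  then have f: "(SOME y. y \<in> R x) \<in> R x" if "x \<in> I" for x using that by (simp add: some_in_eq)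
  show ?thesis
  proof (intro exI[of _ "\<lambda>x. SOME y. y \<in> R x"] conjI ballI)
    show "inj_on (\<lambda>x. SOME y. y \<in> R x) I"
    proof (rule inj_onI, rule ccontr)
      fix u v assume uv: "u \<in> I" "v \<in> I" "(SOME y. y \<in> R u) = (SOME y. y \<in> R v)" "u \<noteq> v"
      \<comment> \<open>Two points with the same only partner would violate the Hall condition as a
        pair.\<close>
      have "(\<Union>x\<in>{u, v}. R x) \<subseteq> {SOME y. y \<in> R u}"
        using uniq[OF uv(1) _ f[OF uv(1)]] uniq[OF uv(2) _ f[OF uv(2)]] uv(3) by auto
      then have "card (\<Union>x\<in>{u, v}. R x) \<le> card {SOME y. y \<in> R u}" by (intro card_mono) auto
      with hallR[of "{u, v}"] uv show False by simp
    qed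
  next
    show "(SOME y. y \<in> R x) \<in> N x" if "x \<in> I" for x using f[OF that] by (simp add: R_def)
  qed
qed

subsection \<open>From an invariant measure to Folner sets\<close>

lemma r_coset_eq_image: "E #>\<^bsub>G\<^esub> k = (\<lambda>x. x \<otimes>\<^bsub>G\<^esub> k) ` E"
  by (auto simp: r_coset_def)

lemma l_coset_eq_image: "k <#\<^bsub>G\<^esub> E = (\<lambda>x. k \<otimes>\<^bsub>G\<^esub> x) ` E"
  by (auto simp: l_coset_def)

lemma finite_set_mult: "finite H \<Longrightarrow> finite K \<Longrightarrow> finite (H <#>\<^bsub>G\<^esub> K)"
  by (simp add: set_mult_def)

lemma (in monoid_cancel) card_r_coset:
  assumes "E \<subseteq> carrier G" "k \<in> carrier G"
  shows "card (E #> k) = card E"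
  unfolding r_coset_eq_image
  by (rule card_image) (use assms r_cancel in \<open>fastforce simp: inj_on_def\<close>)

text \<open>The measure is preserved by every injection that moves points by finitely many right
  multiplications, since the preimage of \<open>D k\<close> under \<open>x \<mapsto> x k\<close> is \<open>D\<close> by cancellation.\<close>

lemma (in monoid_cancel) invariant_measure_piecewise:
  fixes \<mu> :: "'a set \<Rightarrow> real"
  assumes add: "\<And>D E. D \<subseteq> carrier G \<Longrightarrow> E \<subseteq> carrier G \<Longrightarrow> D \<inter> E = {} \<Longrightarrow> \<mu> (D \<union> E) = \<mu> D + \<mu> E"
    and inv: "\<And>s E. s \<in> carrier G \<Longrightarrow> E \<subseteq> carrier G \<Longrightarrow> \<mu> {x \<in> carrier G. x \<otimes> s \<in> E} = \<mu> E"
    and L: "finite L" "L \<subseteq> carrier G"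
    and D: "D \<subseteq> carrier G" "\<And>x. x \<in> D \<Longrightarrow> \<kappa> x \<in> L"
    and inj: "inj_on (\<lambda>x. x \<otimes> \<kappa> x) D"
  shows "\<mu> ((\<lambda>x. x \<otimes> \<kappa> x) ` D) = \<mu> D"
  using L D inj
proof (induction L arbitrary: D rule: finite_induct)
  case empty
  then have "D = {}" by blast
  then show ?case by simp
next
  case (insert l L)
  \<comment> \<open>Split off the points moved by \<open>l\<close>. The remaining points are moved
    by \<open>L\<close> alone, and injectivity keeps the two images disjoint, so additivity
    applies.\<close>
  define D1 where "D1 = {x \<in> D. \<kappa> x = l}"
  define D2 where "D2 = {x \<in> D. \<kappa> x \<noteq> l}"
  let ?h = "\<lambda>x. x \<otimes> \<kappa> x"
  have D: "D = D1 \<union> D2" "D1 \<inter> D2 = {}" "D1 \<subseteq> carrier G" "D2 \<subseteq> carrier G"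
    using insert.prems by (auto simp: D1_def D2_def)
  have l: "l \<in> carrier G" using insert.prems by blast
  have "inj_on ?h D2" using insert.prems(4) by (rule inj_on_subset) (simp add: D2_def)
  moreover have "\<kappa> x \<in> L" if "x \<in> D2" for x using insert.prems(3)[of x] that by (auto simp: D2_def)
  ultimately have 2: "\<mu> (?h ` D2) = \<mu> D2" using insert.IH[of D2] insert.prems(1) D by auto
  have im1: "?h ` D1 = (\<lambda>x. x \<otimes> l) ` D1" by (auto simp: D1_def)
  have carr1: "?h ` D1 \<subseteq> carrier G" unfolding im1 using D(3) l by auto
  have "{x \<in> carrier G. x \<otimes> l \<in> ?h ` D1} = D1"
    unfolding im1 using D(3) l r_cancel by fastforce
  with inv[OF l carr1] have 1: "\<mu> (?h ` D1) = \<mu> D1" by simp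
  have carr2: "?h ` D2 \<subseteq> carrier G" using D(4) insert.prems(1,3) by (auto simp: D2_def)
  have "?h ` D1 \<inter> ?h ` D2 = {}"
    using insert.prems(4) D by (subst inj_on_image_Int[symmetric, of _ D]) auto
  then have "\<mu> (?h ` D1 \<union> ?h ` D2) = \<mu> D1 + \<mu> D2" using add[OF carr1 carr2] 1 2 by simp
  also have "\<dots> = \<mu> D" using add[OF D(3,4,2)] D(1) by simp
  finally show ?case by (simp add: D(1) image_Un)
qed

text \<open>If there were no Folner sets, the sets \<open>E L\<close> would grow by a factor of at least two for a
  suitable finite \<open>L\<close>. Hall's theorem would then give two injections of \<open>S\<close> with disjoint images
  that move points by elements of \<open>L\<close>, so that \<open>\<mu> S \<ge> 2\<close>.\<close>

lemma (in monoid_cancel) right_amenable_imp_Folner: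
  assumes am: "right_amenable G" and K: "finite K" "K \<subseteq> carrier G" and e: "e > 0"
  shows "\<exists>F. F \<subseteq> carrier G \<and> finite F \<and> F \<noteq> {} \<and>
    (\<forall>s\<in>K. real (card ((F #> s) - F)) \<le> e * real (card F))"
proof (rule ccontr)
  assume neg: "\<not> ?thesis"
  \<comment> \<open>With the unit adjoined, \<open>E <#> K1\<close> contains \<open>E\<close> itself
    besides the more than e|E| new points that some \<open>s\<close> in \<open>K\<close>
    contributes.\<close>
  define K1 where "K1 = insert \<one> K"
  have K1: "finite K1" "K1 \<subseteq> carrier G" using K by (auto simp: K1_def)
  have grow: "(1 + e) * real (card E) \<le> real (card (E <#> K1))"
    if E: "E \<subseteq> carrier G" "finite E" for E
  proof (cases "E = {}")
    case False
    with neg E obtain s where s: "s \<in> K" "real (card ((E #> s) - E)) > e * real (card E)"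
      by (auto simp: not_le)
    have "E \<union> ((E #> s) - E) \<subseteq> E <#> K1"
      using s E by (force simp: set_mult_def r_coset_def K1_def)
    then have "card (E \<union> ((E #> s) - E)) \<le> card (E <#> K1)"
      using E K1 by (intro card_mono finite_set_mult)
    moreover have "card (E \<union> ((E #> s) - E)) = card E + card ((E #> s) - E)"
      using E by (intro card_Un_disjoint) (auto simp: r_coset_eq_image)
    ultimately show ?thesis using s by (simp add: algebra_simps)
  qed (simp add: set_mult_def)
  \<comment> \<open>The witness is the n-fold product of \<open>K1\<close>: \<open>grow\<close>
    holds for every finite set, so it may be applied again to \<open>E <#> L\<close>.\<close>
  have "\<exists>L. finite L \<and> L \<subseteq> carrier G \<and>
      (\<forall>E. E \<subseteq> carrier G \<longrightarrow> finite E \<longrightarrow> (1 + e) ^ n * real (card E) \<le> real (card (E <#> L)))" for n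
  proof (induction n)
    case 0
    have "E <#> {\<one>} = E" if "E \<subseteq> carrier G" for E using that by (force simp: set_mult_def)
    then show ?case by (intro exI[of _ "{\<one>}"]) auto
  next
    case (Suc n)
    then obtain L where L: "finite L" "L \<subseteq> carrier G"
      "\<And>E. E \<subseteq> carrier G \<Longrightarrow> finite E \<Longrightarrow> (1 + e) ^ n * real (card E) \<le> real (card (E <#> L))" by blast
    have "(1 + e) ^ Suc n * real (card E) \<le> real (card (E <#> (L <#> K1)))"
      if E: "E \<subseteq> carrier G" "finite E" for E
    proof -
      have "(1 + e) ^ Suc n * real (card E) = (1 + e) * ((1 + e) ^ n * real (card E))" by simp
      also have "\<dots> \<le> (1 + e) * real (card (E <#> L))"
        using L(3)[OF E] e by (intro mult_left_mono) auto
      also have "\<dots> \<le> real (card ((E <#> L) <#> K1))"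
        using E L by (intro grow finite_set_mult set_mult_closed)
      also have "(E <#> L) <#> K1 = E <#> (L <#> K1)"
      proof -
        have "x \<otimes> (y \<otimes> z) = x \<otimes> y \<otimes> z" if "x \<in> E" "y \<in> L" "z \<in> K1" for x y z
          using that E L K1 by (simp add: m_assoc subset_iff)
        then show ?thesis unfolding set_mult_def by fastforce
      qed
      finally show ?thesis .
    qed
    then show ?case
      using finite_set_mult[OF L(1) K1(1)] set_mult_closed[OF L(2) K1(2)] by blast
  qed
  note pow = this
  obtain n where n: "2 < (1 + e) ^ n" using e real_arch_pow[of "1 + e" 2] by auto
  obtain L where L: "finite L" "L \<subseteq> carrier G"
    and Ln: "\<And>E. E \<subseteq> carrier G \<Longrightarrow> finite E \<Longrightarrow> (1 + e) ^ n * real (card E) \<le> real (card (E <#> L))"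
    using pow[of n] by blast
  have dbl: "2 * card E \<le> card (E <#> L)" if E: "E \<subseteq> carrier G" "finite E" for E
  proof -
    have "2 * real (card E) \<le> (1 + e) ^ n * real (card E)"
      using n by (intro mult_right_mono) auto
    also note Ln[OF E]
    finally show ?thesis by linarith
  qed
  \<comment> \<open>Two copies of each element: representatives for this doubled family are a pair
    of injections of the carrier with disjoint images, and growth by the factor 2 is exactly its
    Hall condition.\<close>
  define I where "I = carrier G \<times> (UNIV :: bool set)"
  have finL: "finite (fst p <# L)" for p :: "'a \<times> bool" using L by (simp add: l_coset_eq_image)
  have hallL: "card F \<le> card (\<Union>p\<in>F. fst p <# L)" if F: "F \<subseteq> I" "finite F" for F
  proof -
    have "card F \<le> card (fst ` F \<times> (UNIV :: bool set))"
    proof (rule card_mono)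
      show "F \<subseteq> fst ` F \<times> UNIV" by force
    qed (use F in auto)
    also have "\<dots> = 2 * card (fst ` F)" by (simp add: card_cartesian_product)
    also have "\<dots> \<le> card (fst ` F <#> L)" using F by (intro dbl) (auto simp: I_def)
    also have "fst ` F <#> L = (\<Union>p\<in>F. fst p <# L)" by (auto simp: set_mult_def l_coset_def)
    finally show ?thesis .
  qed
  have "\<exists>f. inj_on f I \<and> (\<forall>p\<in>I. f p \<in> fst p <# L)"
    by (rule marriage_inj) (simp_all add: finL hallL)
  then obtain f where f: "inj_on f I" "\<And>p. p \<in> I \<Longrightarrow> f p \<in> fst p <# L" by blast
  from am obtain \<mu> :: "'a set \<Rightarrow> real" where
      le1: "\<forall>E. E \<subseteq> carrier G \<longrightarrow> 0 \<le> \<mu> E \<and> \<mu> E \<le> 1" and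
      addall: "\<forall>D E. D \<subseteq> carrier G \<longrightarrow> E \<subseteq> carrier G \<longrightarrow> D \<inter> E = {} \<longrightarrow> \<mu> (D \<union> E) = \<mu> D + \<mu> E" and
      \<mu>1: "\<mu> (carrier G) = 1" and
      invall: "\<forall>s\<in>carrier G. \<forall>E. E \<subseteq> carrier G \<longrightarrow> \<mu> {x \<in> carrier G. x \<otimes> s \<in> E} = \<mu> E"
    unfolding right_amenable_def by (elim exE conjE)
  note \<mu>add = addall[rule_format] and \<mu>inv = invall[rule_format]
  have "\<exists>k. k \<in> L \<and> f p = fst p \<otimes> k" if "p \<in> I" for p
    using f(2)[OF that] by (auto simp: l_coset_def)
  then obtain \<kappa> where \<kappa>: "\<And>p. p \<in> I \<Longrightarrow> \<kappa> p \<in> L" "\<And>p. p \<in> I \<Longrightarrow> f p = fst p \<otimes> \<kappa> p"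
    by metis
  have img: "(\<lambda>x. x \<otimes> \<kappa> (x, b)) ` carrier G = f ` (carrier G \<times> {b})" for b
  proof -
    have "f ` (carrier G \<times> {b}) = (\<lambda>x. f (x, b)) ` carrier G" by force
    then show ?thesis using \<kappa>(2) by (auto simp: I_def image_iff)
  qed
  have one: "\<mu> (f ` (carrier G \<times> {b})) = 1" for b
  proof -
    have "inj_on (\<lambda>x. x \<otimes> \<kappa> (x, b)) (carrier G)"
    proof (rule inj_onI)
      fix x y assume xy: "x \<in> carrier G" "y \<in> carrier G" "x \<otimes> \<kappa> (x, b) = y \<otimes> \<kappa> (y, b)"
      then have "f (x, b) = f (y, b)" by (simp add: \<kappa>(2) I_def)
      with f(1) xy show "x = y" by (auto simp: inj_on_def I_def)
    qed
    then have "\<mu> ((\<lambda>x. x \<otimes> \<kappa> (x, b)) ` carrier G) = \<mu> (carrier G)"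
      using \<kappa>(1) by (intro invariant_measure_piecewise[OF \<mu>add \<mu>inv L]) (auto simp: I_def)
    then show ?thesis using \<mu>1 img[of b] by simp
  qed
  have carr: "f ` (carrier G \<times> {b}) \<subseteq> carrier G" for b
    unfolding img[of b, symmetric] using \<kappa>(1) L by (auto simp: I_def)
  have "f ` (carrier G \<times> {True}) \<inter> f ` (carrier G \<times> {False}) = {}"
    using f(1) by (auto simp: inj_on_def I_def)
  then have "\<mu> (f ` (carrier G \<times> {True}) \<union> f ` (carrier G \<times> {False})) = 2"
    using \<mu>add[OF carr carr] one by simp
  moreover have "\<mu> (f ` (carrier G \<times> {True}) \<union> f ` (carrier G \<times> {False})) \<le> 1"
    using le1 carr by simp
  ultimately show False by simp
qed

text \<open>The index (K, n) asks for invariance under \<open>K\<close> up to 1/(n + 1);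
  \<open>Suc\<close> keeps the tolerance positive at n = 0. The value is meaningful once amenability
  supplies such a set.\<close>

definition Folner_choice :: "('s, 'm) monoid_scheme \<Rightarrow> 's set \<times> nat \<Rightarrow> 's set" where
  "Folner_choice S p = (SOME F. F \<subseteq> carrier S \<and> finite F \<and> F \<noteq> {} \<and>
     (\<forall>s\<in>fst p. real (card ((F #>\<^bsub>S\<^esub> s) - F)) \<le> 1 / real (Suc (snd p)) * real (card F)))"

text \<open>At least one net is needed to make the limit in \<open>H_alg\<close> unique. Beyond the
  index ({s}, n), the defect ratio at \<open>s\<close> is at most 1/(n + 1).\<close>

lemma (in monoid_cancel) right_Folner_net_exists:
  assumes am: "right_amenable G"
  shows "right_Folner_net G {p. finite (fst p) \<and> fst p \<subseteq> carrier G}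
    (\<lambda>p q. fst p \<subseteq> fst q \<and> snd p \<le> snd q) (Folner_choice G)"
    (is "right_Folner_net G ?I ?leq ?F")
proof -
  have F: "?F p \<subseteq> carrier G \<and> finite (?F p) \<and> ?F p \<noteq> {} \<and>
     (\<forall>s\<in>fst p. real (card ((?F p #> s) - ?F p)) \<le> 1 / real (Suc (snd p)) * real (card (?F p)))"
    if "p \<in> ?I" for p
    unfolding Folner_choice_def
    by (rule someI_ex, rule right_amenable_imp_Folner[OF am]) (use that in auto)
  have dir: "directed_set ?I ?leq"
    unfolding directed_set_def
  proof (intro conjI ballI impI)
    show "?I \<noteq> {}" by (rule ex_in_conv[THEN iffD1], rule exI[of _ "({}, 0)"]) simp
    fix p q assume "p \<in> ?I" "q \<in> ?I"
    then show "\<exists>k\<in>?I. ?leq p k \<and> ?leq q k"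
      by (intro bexI[of _ "(fst p \<union> fst q, max (snd p) (snd q))"]) auto
  qed auto
  have "((\<lambda>i. real (card ((?F i #> s) - ?F i)) / real (card (?F i))) \<longlongrightarrow> 0) (net_filter ?I ?leq)"
    if s: "s \<in> carrier G" for s
  proof (rule tendstoI)
    fix e :: real assume "e > 0"
    then obtain n where n: "1 / real (Suc n) < e" using nat_approx_posE by blast
    have "dist (real (card ((?F p #> s) - ?F p)) / real (card (?F p))) 0 < e"
      if p: "p \<in> ?I" "?leq ({s}, n) p" for p
    proof -
      have "card (?F p) > 0" using F[OF p(1)] by (simp add: card_gt_0_iff)
      moreover have "real (card ((?F p #> s) - ?F p)) \<le> 1 / real (Suc (snd p)) * real (card (?F p))"
        using F[OF p(1)] p(2) by auto
      ultimately have "real (card ((?F p #> s) - ?F p)) / real (card (?F p)) \<le> 1 / real (Suc (snd p))"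
        by (subst pos_divide_le_eq) auto
      also have "\<dots> \<le> 1 / real (Suc n)" using p(2) by (auto simp: field_simps)
      finally show ?thesis using n by simp
    qed
    then show "eventually (\<lambda>i. dist (real (card ((?F i #> s) - ?F i)) / real (card (?F i))) 0 < e)
        (net_filter ?I ?leq)"
      unfolding eventually_net_filter[OF dir] using s by (intro bexI[of _ "({s}, n)"]) auto
  qed
  then show ?thesis unfolding right_Folner_net_def using dir F by simp
qed

subsection \<open>Finite subgroups\<close>

lemma card_pos_subgroup: "subgroup H G \<Longrightarrow> finite H \<Longrightarrow> 0 < card H"
  using subgroup.one_closed card_gt_0_iff by fastforce

lemma card_set_mult_le:
  assumes "finite H" "finite K"
  shows "card (H <#>\<^bsub>G\<^esub> K) \<le> card H * card K"
proof -
  have "H <#>\<^bsub>G\<^esub> K = (\<lambda>p. fst p \<otimes>\<^bsub>G\<^esub> snd p) ` (H \<times> K)" by (force simp: set_mult_def)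
  then show ?thesis using card_image_le[of "H \<times> K"] assms by (simp add: card_cartesian_product)
qed

text \<open>Every fibre of \<open>h\<close> on \<open>T\<close> is a translate of the part of the
  kernel in \<open>T\<close>, so all fibres have the same size.\<close>

lemma (in group_hom) card_subgroup_eq_card_image_mult_card_kernel:
  assumes T: "subgroup T G" "finite T"
  shows "card T = card (h ` T) * card {x \<in> T. h x = \<one>\<^bsub>H\<^esub>}"
proof -
  note sub = subgroup.subset[OF T(1)]
  let ?N = "{x \<in> T. h x = \<one>\<^bsub>H\<^esub>}"
  have fiber: "card {x \<in> T. h x = h t} = card ?N" if t: "t \<in> T" for t
  proof -
    have tc: "t \<in> carrier G" using t sub by blast
    have "{x \<in> T. h x = h t} = (\<lambda>x. x \<otimes> t) ` ?N"
    proof (intro equalityI subsetI)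
      fix x assume x: "x \<in> {x \<in> T. h x = h t}"
      then have xc: "x \<in> carrier G" using sub by blast
      have "x \<otimes> inv t \<in> ?N"
        using x t xc tc T(1) by (auto simp: subgroup.m_closed subgroup.m_inv_closed)
      moreover have "x = (x \<otimes> inv t) \<otimes> t" using xc tc by (simp add: G.m_assoc)
      ultimately show "x \<in> (\<lambda>x. x \<otimes> t) ` ?N" by blast
    next
      fix x assume "x \<in> (\<lambda>x. x \<otimes> t) ` ?N"
      then show "x \<in> {x \<in> T. h x = h t}"
        using t tc sub T(1) by (auto simp: subgroup.m_closed subset_iff)
    qed
    moreover have "inj_on (\<lambda>x. x \<otimes> t) ?N"
      using tc sub by (auto simp: inj_on_def subset_iff)
    ultimately show ?thesis by (simp add: card_image)
  qed
  have "card T = (\<Sum>x\<in>T. 1)" by simp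
  also have "\<dots> = (\<Sum>z\<in>h ` T. \<Sum>x | x \<in> T \<and> h x = z. 1)"
    using T(2) by (intro sum.group[symmetric]) auto
  also have "\<dots> = (\<Sum>z\<in>h ` T. card ?N)"
    using fiber by (intro sum.cong) auto
  finally show ?thesis by simp
qed

section \<open>Products and cosets of finite subgroups of an abelian group\<close>

context comm_group
begin

lemma group_hom_Mod: "subgroup B G \<Longrightarrow> group_hom G (G Mod B) (\<lambda>x. B #> x)"
  by (simp add: group_hom.intro group_hom_axioms.intro normal.factorgroup_is_group
      normal.r_coset_hom_Mod subgroup_imp_normal)

lemma card_subgroup_eq_card_cosets_mult:
  assumes "subgroup B G" "subgroup T G" "finite T"
  shows "card T = card ((\<lambda>x. B #> x) ` T) * card (T \<inter> B)"
proof -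
  have "{x \<in> T. B #> x = B} = T \<inter> B"
    using assms(1) subgroup.subset[OF assms(2)] coset_join1[OF _ _ assms(1)]
      coset_join2[OF _ assms(1)] subgroup.subset[OF assms(1)] by blast
  then show ?thesis
    using group_hom.card_subgroup_eq_card_image_mult_card_kernel[OF group_hom_Mod[OF assms(1)] assms(2,3)]
    by simp
qed

lemma subgroup_le_set_mult:
  assumes "subgroup P G" "subgroup Q G"
  shows "P \<subseteq> P <#> Q" "Q \<subseteq> P <#> Q"
proof -
  note c = subgroup.subset[OF assms(1)] subgroup.subset[OF assms(2)]
  show "P \<subseteq> P <#> Q"
  proof
    fix x assume "x \<in> P"
    then show "x \<in> P <#> Q"
      using c subgroup.one_closed[OF assms(2)] r_one[of x] unfolding set_mult_def by force
  qed
  show "Q \<subseteq> P <#> Q"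
  proof
    fix x assume "x \<in> Q"
    then show "x \<in> P <#> Q"
      using c subgroup.one_closed[OF assms(1)] l_one[of x] unfolding set_mult_def by force
  qed
qed

lemma set_mult_subset_subgroup: "subgroup R G \<Longrightarrow> P \<subseteq> R \<Longrightarrow> Q \<subseteq> R \<Longrightarrow> P <#> Q \<subseteq> R"
  by (auto simp: set_mult_def subset_iff subgroup.m_closed)

lemma coset_image_set_mult:
  assumes "subgroup P G" "subgroup Q G"
  shows "(\<lambda>x. P #> x) ` (P <#> Q) = (\<lambda>x. P #> x) ` Q"
proof -
  have "P #> (p \<otimes> q) = P #> q" if "p \<in> P" "q \<in> Q" for p q
    using that assms subgroup.subset[OF assms(1)] subgroup.subset[OF assms(2)]
      coset_mult_assoc[of P p q] coset_join2[of p P] by (simp add: subset_iff)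
  moreover have "Q \<subseteq> P <#> Q" by (rule subgroup_le_set_mult) fact+
  ultimately show ?thesis by (auto simp: set_mult_def)
qed

lemma card_set_mult_eq_cosets:
  assumes "subgroup P G" "subgroup Q G" "finite P" "finite Q"
  shows "card (P <#> Q) = card ((\<lambda>x. P #> x) ` Q) * card P"
proof -
  have "(P <#> Q) \<inter> P = P" using subgroup_le_set_mult[OF assms(1,2)] by blast
  then show ?thesis
    using card_subgroup_eq_card_cosets_mult[OF assms(1) mult_subgroups[OF assms(1,2)]] assms
    by (simp add: coset_image_set_mult finite_set_mult)
qed

lemma card_set_mult_Int:
  assumes "subgroup P G" "subgroup Q G" "finite P" "finite Q"
  shows "card (P <#> Q) * card (P \<inter> Q) = card P * card Q"
  using card_set_mult_eq_cosets[OF assms] card_subgroup_eq_card_cosets_mult[OF assms(1,2,4)]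
  by (simp add: Int_commute)

text \<open>Adjoin the elements one at a time: a torsion element generates a finite cyclic group,
  and in an abelian group the product of two finite subgroups is again a finite subgroup.\<close>

lemma torsion_finite_subgroup:
  assumes tor: "torsion_group G" and U: "finite U" "U \<subseteq> carrier G"
  shows "\<exists>H. subgroup H G \<and> finite H \<and> U \<subseteq> H"
  using U
proof (induction U rule: finite_induct)
  case empty
  show ?case using triv_subgroup by blast
next
  case (insert a U)
  then obtain H where H: "subgroup H G" "finite H" "U \<subseteq> H" by auto
  have a: "a \<in> carrier G" using insert by simp
  obtain n :: nat where n: "n > 0" "a [^] n = \<one>" using tor a by (auto simp: torsion_group_def)
  let ?P = "generate G {a}"
  have P: "subgroup ?P G" using a by (intro generate_is_subgroup) simp
  have "a [^] k \<in> (\<lambda>i::int. a [^] i) ` {0..<int n}" for k :: int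
  proof -
    \<comment> \<open>Division with remainder by an exponent killing \<open>a\<close> leaves only
      the powers 0, ..., n - 1.\<close>
    have "a [^] k = a [^] (int n * (k div int n) + k mod int n)" by simp
    also have "\<dots> = (a [^] int n) [^] (k div int n) \<otimes> a [^] (k mod int n)"
      using a by (subst int_pow_mult) (simp_all add: int_pow_pow)
    also have "\<dots> = a [^] (k mod int n)" using a n by (simp add: int_pow_int)
    finally show ?thesis using n by (intro image_eqI[of _ _ "k mod int n"]) auto
  qed
  then have "?P \<subseteq> (\<lambda>i::int. a [^] i) ` {0..<int n}" unfolding generate_pow[OF a] by blast
  then have fP: "finite ?P" by (rule finite_subset) simp
  have "a \<in> ?P" by (rule generate.incl) simp
  then have "insert a U \<subseteq> ?P <#> H" using subgroup_le_set_mult[OF P H(1)] H(3) by blast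
  then show ?case using mult_subgroups[OF P H(1)] finite_set_mult[OF fP H(2)] by blast
qed

end

subsection \<open>Trajectories\<close>

lemma (in comm_monoid) trajectory_empty: "trajectory G \<alpha> {} X = {\<one>}"
  by (auto simp: trajectory_def)

text \<open>Replaces choice functions by products of sets, so that facts on trajectories can be
  proved by induction on \<open>F\<close>.\<close>

lemma (in comm_monoid) trajectory_insert:
  assumes F: "finite F" "s \<notin> F" and X: "\<And>t. t \<in> insert s F \<Longrightarrow> \<alpha> t ` X \<subseteq> carrier G"
  shows "trajectory G \<alpha> (insert s F) X = \<alpha> s ` X <#> trajectory G \<alpha> F X"
proof (intro equalityI subsetI)
  fix z assume "z \<in> trajectory G \<alpha> (insert s F) X"
  then obtain y where y: "z = finprod G y (insert s F)" "\<forall>t\<in>insert s F. y t \<in> \<alpha> t ` X"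
    by (auto simp: trajectory_def)
  have c: "y t \<in> carrier G" if "t \<in> insert s F" for t using X[OF that] y(2) that by blast
  then have "z = y s \<otimes> finprod G y F" using F y(1) by (simp add: finprod_insert Pi_def)
  moreover have "finprod G y F \<in> trajectory G \<alpha> F X" using y(2) by (auto simp: trajectory_def)
  ultimately show "z \<in> \<alpha> s ` X <#> trajectory G \<alpha> F X"
    using y(2) unfolding set_mult_def by blast
next
  fix z assume "z \<in> \<alpha> s ` X <#> trajectory G \<alpha> F X"
  then obtain a y where y: "z = a \<otimes> finprod G y F" "a \<in> \<alpha> s ` X" "\<forall>t\<in>F. y t \<in> \<alpha> t ` X"
    by (auto simp: trajectory_def set_mult_def)
  have c: "y t \<in> carrier G" if "t \<in> F" for t using X[of t] y(3) that by blast
  \<comment> \<open>A choice on \<open>F\<close> is extended by the value \<open>a\<close> at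
    \<open>s\<close>; as \<open>s\<close> is not in \<open>F\<close>, the product over
    \<open>F\<close> does not change.\<close>
  have "finprod G (y(s := a)) (insert s F) = a \<otimes> finprod G (y(s := a)) F"
    using F c X y(2) by (subst finprod_insert) (auto simp: Pi_def)
  also have "finprod G (y(s := a)) F = finprod G y F"
    using F c by (intro finprod_cong') (auto simp: Pi_def)
  finally have "z = finprod G (y(s := a)) (insert s F)" unfolding y(1) by (rule sym)
  moreover have "\<forall>t\<in>insert s F. (y(s := a)) t \<in> \<alpha> t ` X" using y(2,3) by simp
  ultimately show "z \<in> trajectory G \<alpha> (insert s F) X" unfolding trajectory_def by blast
qed

locale cancel_monoid_action = S: monoid_cancel S + comm_group A
  for S :: "('s, 'm) monoid_scheme" and A :: "('a, 'n) monoid_scheme" (structure) +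
  fixes \<alpha> :: "'s \<Rightarrow> 'a \<Rightarrow> 'a"
  assumes action: "left_action S A \<alpha>"
begin

lemma act_hom: "s \<in> carrier S \<Longrightarrow> group_hom A A (\<alpha> s)"
  using action by (simp add: left_action_def group_hom.intro group_hom_axioms.intro is_group)

lemma act_mult:
  "s \<in> carrier S \<Longrightarrow> t \<in> carrier S \<Longrightarrow> a \<in> carrier A \<Longrightarrow> \<alpha> (s \<otimes>\<^bsub>S\<^esub> t) a = \<alpha> s (\<alpha> t a)"
  using action by (simp add: left_action_def)

lemma act_one: "a \<in> carrier A \<Longrightarrow> \<alpha> \<one>\<^bsub>S\<^esub> a = a"
  using action by (simp add: left_action_def)

lemma act_subgroup: "s \<in> carrier S \<Longrightarrow> subgroup X A \<Longrightarrow> subgroup (\<alpha> s ` X) A"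
  using act_hom group_hom.subgroup_img_is_subgroup by blast

lemma act_subset: "s \<in> carrier S \<Longrightarrow> X \<subseteq> carrier A \<Longrightarrow> \<alpha> s ` X \<subseteq> carrier A"
  using group_hom.hom_closed[OF act_hom] by blast

abbreviation traj :: "'s set \<Rightarrow> 'a set \<Rightarrow> 'a set" where
  "traj \<equiv> trajectory A \<alpha>"

lemma traj_insert:
  assumes "finite F" "s \<notin> F" "insert s F \<subseteq> carrier S" "X \<subseteq> carrier A"
  shows "traj (insert s F) X = \<alpha> s ` X <#> traj F X"
  using assms act_subset by (intro trajectory_insert) blast+

lemma traj_subgroup:
  assumes "finite F" "F \<subseteq> carrier S" and X: "subgroup X A"
  shows "subgroup (traj F X) A"
  using assms(1,2)
proof (induction F rule: finite_induct)
  case empty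
  show ?case by (simp add: trajectory_empty triv_subgroup)
next
  case (insert s F)
  then show ?case
    using X by (simp add: traj_insert subgroup.subset act_subgroup mult_subgroups)
qed

lemma traj_finite:
  assumes "finite F" "F \<subseteq> carrier S" "X \<subseteq> carrier A" "finite X"
  shows "finite (traj F X)"
  using assms(1,2)
proof (induction F rule: finite_induct)
  case empty
  show ?case by (simp add: trajectory_empty)
next
  case (insert s F)
  then show ?case using assms(3,4) by (simp add: traj_insert finite_set_mult)
qed

text \<open>Together with \<open>traj_upper\<close> this makes the trajectory of a subgroup
  \<open>X\<close> the smallest subgroup containing all \<alpha>(s)(X) with s in \<open>F\<close>;
  inclusions between trajectories are derived from these two facts.\<close>

lemma traj_least:
  assumes "finite F" "F \<subseteq> carrier S" "X \<subseteq> carrier A" "subgroup H A"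
    and "\<And>s. s \<in> F \<Longrightarrow> \<alpha> s ` X \<subseteq> H"
  shows "traj F X \<subseteq> H"
  using assms(1,2,5)
proof (induction F rule: finite_induct)
  case empty
  show ?case using assms(4) by (simp add: trajectory_empty subgroup.one_closed)
next
  case (insert s F)
  then show ?case
    using assms(3,4) by (simp add: traj_insert set_mult_subset_subgroup)
qed

lemma traj_upper:
  assumes "finite F" "F \<subseteq> carrier S" "subgroup X A" "s \<in> F"
  shows "\<alpha> s ` X \<subseteq> traj F X"
proof -
  have "traj (insert s (F - {s})) X = \<alpha> s ` X <#> traj (F - {s}) X"
    using assms subgroup.subset[OF assms(3)] by (intro traj_insert) auto
  moreover have "insert s (F - {s}) = F" using assms(4) by blast
  moreover have "subgroup (\<alpha> s ` X) A" "subgroup (traj (F - {s}) X) A"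
    using assms by (auto intro!: act_subgroup traj_subgroup)
  ultimately show ?thesis using subgroup_le_set_mult(1) by metis
qed

lemma traj_mono:
  assumes "finite E" "E \<subseteq> carrier S" "subgroup Y A" "F \<subseteq> E" "X \<subseteq> Y"
  shows "traj F X \<subseteq> traj E Y"
proof (rule traj_least)
  show "X \<subseteq> carrier A" using assms(3,5) subgroup.subset by blast
  show "subgroup (traj E Y) A" using assms by (intro traj_subgroup)
  show "\<alpha> s ` X \<subseteq> traj E Y" if "s \<in> F" for s
    using traj_upper[OF assms(1-3), of s] that assms(4,5) by blast
  show "finite F" using assms(1,4) by (rule rev_finite_subset)
  show "F \<subseteq> carrier S" using assms(2,4) by blast
qed

lemma traj_singleton:
  assumes "s \<in> carrier S" "subgroup X A"
  shows "traj {s} X = \<alpha> s ` X"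
proof
  show "traj {s} X \<subseteq> \<alpha> s ` X"
    using assms by (intro traj_least) (simp_all add: subgroup.subset act_subgroup)
  show "\<alpha> s ` X \<subseteq> traj {s} X"
    using assms by (intro traj_upper) simp_all
qed

text \<open>For a left action \<alpha>(s k) = \<alpha>(s) \<circ> \<alpha>(k), so left translates s
  K are the ones on which growth is controlled by growth on \<open>K\<close>.\<close>

lemma traj_translate_subset:
  assumes "finite K" "K \<subseteq> carrier S" "s \<in> carrier S" "subgroup X A"
  shows "traj (s <#\<^bsub>S\<^esub> K) X \<subseteq> \<alpha> s ` traj K X"
proof (rule traj_least)
  show "subgroup (\<alpha> s ` traj K X) A" by (rule act_subgroup[OF assms(3) traj_subgroup[OF assms(1,2,4)]])
  show "X \<subseteq> carrier A" using assms by (simp add: subgroup.subset)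
  fix t assume "t \<in> s <#\<^bsub>S\<^esub> K"
  then obtain k where k: "k \<in> K" "t = s \<otimes>\<^bsub>S\<^esub> k" by (auto simp: l_coset_def)
  have "\<alpha> t a = \<alpha> s (\<alpha> k a)" if "a \<in> X" for a
    using that k assms subgroup.subset[OF assms(4)] by (auto intro!: act_mult)
  moreover have "\<alpha> k ` X \<subseteq> traj K X" by (rule traj_upper[OF assms(1,2,4) k(1)])
  ultimately show "\<alpha> t ` X \<subseteq> \<alpha> s ` traj K X" by auto
next
  show "finite (s <#\<^bsub>S\<^esub> K)" using assms(1) by (simp add: l_coset_eq_image)
  show "s <#\<^bsub>S\<^esub> K \<subseteq> carrier S" using assms(2,3) by (auto simp: l_coset_eq_image)
qed

end

subsection \<open>Submodular functions\<close>

text \<open>A defective form of Shearer's inequality, which requires every point to be covered \<open>k\<close>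
  times: the last summand pays for the missing multiplicities.\<close>

lemma submodular_cover:
  fixes g :: "'a set \<Rightarrow> real" and k :: nat
  assumes sub: "\<And>E D. finite E \<Longrightarrow> finite D \<Longrightarrow> E \<subseteq> C \<Longrightarrow> D \<subseteq> C \<Longrightarrow> g (E \<union> D) + g (E \<inter> D) \<le> g E + g D"
    and empty: "g {} = 0" and J: "finite J"
    and F: "finite F" "F \<subseteq> C" "\<And>x. x \<in> F \<Longrightarrow> card {j \<in> J. x \<in> E j} \<le> k"
    and c: "\<And>x. x \<in> F \<Longrightarrow> g {x} \<le> c"
  shows "k * g F \<le> (\<Sum>j\<in>J. g (E j \<inter> F)) + c * (\<Sum>x\<in>F. real k - real (card {j \<in> J. x \<in> E j}))"
  using F c
proof (induction F rule: finite_induct)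
  case empty
  then show ?case by (simp add: assms(2))
next
  case (insert x F)
  \<comment> \<open>\<open>d\<close> is the marginal gain of \<open>x\<close> over \<open>F\<close>.
    Gains diminish: \<open>x\<close> gains at least \<open>d\<close> over each smaller set
    \<open>E j \<inter> F\<close>, and over the empty set.\<close>
  define d where "d = g (insert x F) - g F"
  define J' where "J' = {j \<in> J. x \<in> E j}"
  have "d \<le> g {x}"
    using sub[of "{x}" F] insert.hyps insert.prems by (simp add: d_def empty)
  also have "g {x} \<le> c" using insert.prems by simp
  finally have "d \<le> c" .
  have "card J' \<le> k" using insert.prems(2)[of x] by (simp add: J'_def)
  then have 1: "(real k - card J') * d \<le> (real k - card J') * c"
    using \<open>d \<le> c\<close> by (intro mult_left_mono) auto
  have 2: "g (E j \<inter> F) + (if j \<in> J' then d else 0) \<le> g (E j \<inter> insert x F)" if "j \<in> J" for j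
  proof (cases "j \<in> J'")
    case True
    then have x: "x \<in> E j" by (simp add: J'_def)
    have "g (insert x (E j \<inter> F) \<union> F) + g (insert x (E j \<inter> F) \<inter> F) \<le> g (insert x (E j \<inter> F)) + g F"
      using insert.hyps insert.prems by (intro sub) auto
    moreover have "insert x (E j \<inter> F) \<union> F = insert x F" "insert x (E j \<inter> F) \<inter> F = E j \<inter> F"
      "insert x (E j \<inter> F) = E j \<inter> insert x F"
      using insert.hyps x by auto
    ultimately show ?thesis using True by (simp add: d_def)
  next
    case False
    then have "E j \<inter> insert x F = E j \<inter> F" using that by (auto simp: J'_def)
    then show ?thesis using False by simp
  qed
  have "(\<Sum>j\<in>J. g (E j \<inter> F)) + card J' * d = (\<Sum>j\<in>J. g (E j \<inter> F) + (if j \<in> J' then d else 0))"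
    using J by (simp add: sum.distrib sum.If_cases J'_def Int_def)
  also have "\<dots> \<le> (\<Sum>j\<in>J. g (E j \<inter> insert x F))" using 2 by (intro sum_mono) auto
  finally have 3: "(\<Sum>j\<in>J. g (E j \<inter> F)) + card J' * d \<le> (\<Sum>j\<in>J. g (E j \<inter> insert x F))" .
  \<comment> \<open>Of the \<open>k\<close> copies of the gain, \<open>card J'\<close> are charged
    to the sets that contain \<open>x\<close>; each missing one costs at most
    \<open>c\<close>.\<close>
  have "k * g (insert x F) = k * g F + card J' * d + (real k - card J') * d"
    by (simp add: d_def algebra_simps)
  also have "\<dots> \<le> (\<Sum>j\<in>J. g (E j \<inter> F)) + c * (\<Sum>x\<in>F. real k - real (card {j \<in> J. x \<in> E j}))
      + card J' * d + (real k - card J') * c"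
    using insert.IH insert.prems 1 by fastforce
  also have "\<dots> \<le> (\<Sum>j\<in>J. g (E j \<inter> insert x F)) + c * (\<Sum>x\<in>F. real k - real (card {j \<in> J. x \<in> E j}))
      + (real k - card J') * c"
    using 3 by simp
  also have "\<dots> = (\<Sum>j\<in>J. g (E j \<inter> insert x F))
      + c * (\<Sum>x\<in>insert x F. real k - real (card {j \<in> J. x \<in> E j}))"
    using insert.hyps by (simp add: J'_def algebra_simps)
  finally show ?case .
qed

text \<open>Both sides count the pairs (s, t) in F \<times> K with s t = x: left cancellation makes
  \<open>s\<close> determine \<open>t\<close>, right cancellation makes \<open>t\<close> determine
  \<open>s\<close>. In particular no point is covered more than |K| times.\<close>

lemma (in monoid_cancel) cover_multiplicity:
  assumes "finite F" "finite K" "F \<subseteq> carrier G" "K \<subseteq> carrier G"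
  shows "card {s \<in> F. x \<in> s <# K} = card {t \<in> K. x \<in> F #> t}"
proof -
  define P where "P = {(s, t) \<in> F \<times> K. s \<otimes> t = x}"
  have "{s \<in> F. x \<in> s <# K} = fst ` P" "{t \<in> K. x \<in> F #> t} = snd ` P"
    unfolding P_def l_coset_def r_coset_def by force+
  moreover have "t = t'" if "(s, t) \<in> P" "(s, t') \<in> P" for s t t'
    using that assms l_cancel[of s t t'] by (auto simp: P_def)
  then have "inj_on fst P" by (auto simp: inj_on_def)
  moreover have "s = s'" if "(s, t) \<in> P" "(s', t) \<in> P" for s s' t
    using that assms r_cancel[of s t s'] by (auto simp: P_def)
  then have "inj_on snd P" by (auto simp: inj_on_def)
  ultimately show ?thesis by (simp add: card_image)
qed

text \<open>Double counting turns the missing multiplicities into the sum over t of |F| - |F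
  \<inter> F t|, and |F t| = |F| by cancellation. Thus the error of the cover is expressed by the
  defects in the Folner condition.\<close>

lemma (in monoid_cancel) cover_deficiency:
  assumes "finite F" "finite K" "F \<subseteq> carrier G" "K \<subseteq> carrier G"
  shows "(\<Sum>x\<in>F. real (card K) - real (card {s \<in> F. x \<in> s <# K})) = (\<Sum>t\<in>K. real (card ((F #> t) - F)))"
proof -
  have "(\<Sum>x\<in>F. real (card {s \<in> F. x \<in> s <# K})) = (\<Sum>x\<in>F. real (card {t \<in> K. x \<in> F #> t}))"
    using assms by (simp add: cover_multiplicity)
  also have "\<dots> = real (\<Sum>x\<in>F. card {t \<in> K. x \<in> F #> t})" by simp
  also have "(\<Sum>x\<in>F. card {t \<in> K. x \<in> F #> t}) = (\<Sum>t\<in>K. card {x \<in> F. x \<in> F #> t})"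
    using assms(1,2) by (rule sum_multicount_gen) simp
  finally have 1: "(\<Sum>x\<in>F. real (card {s \<in> F. x \<in> s <# K})) = (\<Sum>t\<in>K. real (card {x \<in> F. x \<in> F #> t}))"
    by simp
  have 2: "real (card ((F #> t) - F)) = real (card F) - real (card {x \<in> F. x \<in> F #> t})" if "t \<in> K" for t
  proof -
    have f: "finite (F #> t)" using assms(1) by (simp add: r_coset_eq_image)
    have "card ((F #> t) - F) + card {x \<in> F. x \<in> F #> t} = card (((F #> t) - F) \<union> {x \<in> F. x \<in> F #> t})"
      using f assms(1) by (intro card_Un_disjoint[symmetric]) auto
    also have "((F #> t) - F) \<union> {x \<in> F. x \<in> F #> t} = F #> t" by auto
    also have "card (F #> t) = card F" using assms that by (intro card_r_coset) auto
    finally show ?thesis by simp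
  qed
  have "(\<Sum>t\<in>K. real (card ((F #> t) - F))) = (\<Sum>t\<in>K. real (card F) - real (card {x \<in> F. x \<in> F #> t}))"
    using 2 by (rule sum.cong[OF refl])
  then show ?thesis using 1 by (simp add: sum_subtractf)
qed

section \<open>The covering bound for trajectories modulo a finite subgroup\<close>

context cancel_monoid_action
begin

text \<open>The function \<open>E \<mapsto> ln |T\<^sub>E(X) V / V|\<close> is submodular, because \<open>T\<^sub>E\<^sub>\<inter>\<^sub>D(X)\<close> lies in
  \<open>T\<^sub>E(X) \<inter> T\<^sub>D(X)\<close>. It is covered by the translates \<open>s K\<close> with \<open>s \<in> F\<close>.\<close>

lemma ln_traj_submodular:
  assumes X: "subgroup X A" "finite X" and V: "subgroup V A" "finite V"
    and ED: "finite E" "finite D" "E \<subseteq> carrier S" "D \<subseteq> carrier S"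
  defines "g \<equiv> \<lambda>E. ln (real (card (traj E X <#> V))) - ln (real (card V))"
  shows "g (E \<union> D) + g (E \<inter> D) \<le> g E + g D"
proof -
  have sg: "subgroup (traj E' X <#> V) A" "finite (traj E' X <#> V)" "traj E' X \<subseteq> traj E' X <#> V"
      "V \<subseteq> traj E' X <#> V"
    if "finite E'" "E' \<subseteq> carrier S" for E'
  proof -
    have t: "subgroup (traj E' X) A" "finite (traj E' X)"
      using that X by (auto intro!: traj_subgroup traj_finite subgroup.subset)
    show "subgroup (traj E' X <#> V) A" using t V by (intro mult_subgroups)
    show "finite (traj E' X <#> V)" using t V by (intro finite_set_mult)
    show "traj E' X \<subseteq> traj E' X <#> V" "V \<subseteq> traj E' X <#> V"
      using subgroup_le_set_mult t V by blast+
  qed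
  let ?P = "traj E X <#> V" and ?Q = "traj D X <#> V"
  note P = sg[OF ED(1,3)] and Q = sg[OF ED(2,4)]
  have PQ: "subgroup (?P <#> ?Q) A" "?P \<subseteq> ?P <#> ?Q" "?Q \<subseteq> ?P <#> ?Q"
    using mult_subgroups subgroup_le_set_mult P Q by auto
  have up: "\<alpha> s ` X \<subseteq> ?P <#> ?Q" if "s \<in> E \<union> D" for s
    using that traj_upper[OF ED(1,3) X(1)] traj_upper[OF ED(2,4) X(1)] PQ P Q by blast
  have "traj (E \<union> D) X <#> V \<subseteq> ?P <#> ?Q"
    using ED X(1) up P Q PQ
    by (intro set_mult_subset_subgroup traj_least) (auto simp: subgroup.subset)
  then have 1: "card (traj (E \<union> D) X <#> V) \<le> card (?P <#> ?Q)"
    using finite_set_mult[OF P(2) Q(2)] by (rule card_mono[rotated])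
  have "traj (E \<inter> D) X \<subseteq> ?P" "traj (E \<inter> D) X \<subseteq> ?Q"
    using traj_mono[OF ED(1,3) X(1), of "E \<inter> D" X] traj_mono[OF ED(2,4) X(1), of "E \<inter> D" X] P Q by auto
  then have "traj (E \<inter> D) X <#> V \<subseteq> ?P \<inter> ?Q"
    using P Q by (intro Int_greatest set_mult_subset_subgroup)
  then have 2: "card (traj (E \<inter> D) X <#> V) \<le> card (?P \<inter> ?Q)"
    using P Q by (intro card_mono) auto
  have pos: "card (traj (E \<union> D) X <#> V) > 0" "card (traj (E \<inter> D) X <#> V) > 0" "card ?P > 0" "card ?Q > 0"
    using ED by (auto intro!: card_pos_subgroup sg)
  \<comment> \<open>The product formula |P Q| |P \<inter> Q| = |P| |Q| combines the two
    inclusions.\<close>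
  have "card (traj (E \<union> D) X <#> V) * card (traj (E \<inter> D) X <#> V) \<le> card ?P * card ?Q"
    using mult_le_mono[OF 1 2] card_set_mult_Int[OF P(1) Q(1) P(2) Q(2)] by simp
  then have "real (card (traj (E \<union> D) X <#> V)) * real (card (traj (E \<inter> D) X <#> V))
      \<le> real (card ?P) * real (card ?Q)"
    by (simp flip: of_nat_mult)
  then have "ln (real (card (traj (E \<union> D) X <#> V)) * real (card (traj (E \<inter> D) X <#> V)))
      \<le> ln (real (card ?P) * real (card ?Q))"
    using pos by (subst ln_le_cancel_iff) auto
  then show ?thesis using pos by (simp add: g_def ln_mult)
qed

text \<open>Compose \<alpha>(s) with the projection modulo \<open>V\<close>. On \<open>T\<close> the
  kernel contains \<open>Y\<close>, so the image has at most |T| / |Y| elements.\<close>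

lemma ln_card_image_set_mult_le:
  assumes s: "s \<in> carrier S" and T: "subgroup T A" "finite T" and V: "subgroup V A" "finite V"
    and Y: "subgroup Y A" "Y \<subseteq> T" "\<alpha> s ` Y \<subseteq> V"
  shows "ln (real (card (\<alpha> s ` T <#> V))) - ln (real (card V)) \<le> ln (real (card T)) - ln (real (card Y))"
proof -
  interpret h: group_hom A A "\<alpha> s" by (rule act_hom) fact
  interpret q: group_hom A "A Mod V" "\<lambda>x. V #> x" by (rule group_hom_Mod) fact
  interpret c: group_hom A "A Mod V" "\<lambda>x. V #> \<alpha> s x"
    using Group.hom_compose[OF h.homh q.homh] by unfold_locales (simp add: comp_def)
  have fY: "finite Y" using Y(2) T(2) finite_subset by blast
  have im: "subgroup (\<alpha> s ` T) A" "finite (\<alpha> s ` T)" using act_subgroup s T by auto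
  let ?c = "card ((\<lambda>x. V #> \<alpha> s x) ` T)"
  have "V <#> \<alpha> s ` T = \<alpha> s ` T <#> V"
    using commut_normal[OF im(1) subgroup_imp_normal[OF V(1)]] by simp
  then have 1: "card (\<alpha> s ` T <#> V) = ?c * card V"
    using card_set_mult_eq_cosets[OF V(1) im(1) V(2) im(2)] by (simp add: image_image)
  have "V #> \<alpha> s y = V" if "y \<in> Y" for y
    using that Y V subgroup.subset[OF V(1)] by (intro coset_join2) auto
  then have "card Y \<le> card {x \<in> T. V #> \<alpha> s x = V}"
    using Y(2) T(2) by (intro card_mono) auto
  then have 2: "?c * card Y \<le> card T"
    using c.card_subgroup_eq_card_image_mult_card_kernel[OF T] by simp
  have pos: "card V > 0" "card Y > 0" "card T > 0" "?c > 0"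
    using card_pos_subgroup V Y fY T by (auto simp: card_gt_0_iff dest: subgroup.one_closed)
  have "ln (real (?c * card Y)) \<le> ln (real (card T))" using pos 2
    by (subst ln_le_cancel_iff) (auto simp flip: of_nat_mult)
  then show ?thesis using pos by (simp add: 1 ln_mult)
qed

text \<open>\<open>submodular_cover\<close> for the sets s K with s in \<open>F\<close>: each costs
  at most ln |T_K(X)| - ln |Y|, since \<alpha>(s) maps \<open>Y\<close> into \<open>V\<close>, and
  each missing multiplicity costs at most ln |X|.\<close>

lemma ln_traj_cover:
  assumes X: "subgroup X A" "finite X" and V: "subgroup V A" "finite V"
    and K: "finite K" "K \<subseteq> carrier S" and F: "finite F" "F \<subseteq> carrier S"
    and Y: "subgroup Y A" "Y \<subseteq> traj K X" and YV: "\<And>s. s \<in> F \<Longrightarrow> \<alpha> s ` Y \<subseteq> V"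
  shows "card K * (ln (real (card (traj F X))) - ln (real (card V)))
    \<le> card F * (ln (real (card (traj K X))) - ln (real (card Y)))
      + ln (real (card X)) * (\<Sum>t\<in>K. real (card ((F #>\<^bsub>S\<^esub> t) - F)))"
proof -
  define g where "g E = ln (real (card (traj E X <#> V))) - ln (real (card V))" for E
  have sg: "subgroup (traj E X) A" "finite (traj E X)" if "finite E" "E \<subseteq> carrier S" for E
    using that X by (auto intro!: traj_subgroup traj_finite subgroup.subset)
  have mono: "ln (real (card P)) \<le> ln (real (card Q))" if "P \<subseteq> Q" "subgroup P A" "finite Q" for P Q
    using that card_mono[OF that(3,1)] card_pos_subgroup[OF that(2)] finite_subset[OF that(1,3)]
    by (subst ln_le_cancel_iff) auto
  have gmono: "g E \<le> g D" if "E \<subseteq> D" "finite D" "D \<subseteq> carrier S" for E D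
  proof -
    have fE: "finite E" "E \<subseteq> carrier S" using that finite_subset by auto
    have "traj E X \<subseteq> traj D X" using that X by (intro traj_mono) auto
    then have "traj E X <#> V \<subseteq> traj D X <#> V" unfolding set_mult_def by blast
    then show ?thesis
      using sg[OF fE] sg[OF that(2,3)] V unfolding g_def
      by (intro diff_mono mono mult_subgroups finite_set_mult) auto
  qed
  have tr: "g ((s <#\<^bsub>S\<^esub> K) \<inter> F) \<le> ln (real (card (traj K X))) - ln (real (card Y))" if s: "s \<in> F" for s
  proof -
    have sS: "s \<in> carrier S" using s F by blast
    have sK: "finite (s <#\<^bsub>S\<^esub> K)" "s <#\<^bsub>S\<^esub> K \<subseteq> carrier S"
      using K sS by (auto simp: l_coset_eq_image)
    have "g ((s <#\<^bsub>S\<^esub> K) \<inter> F) \<le> g (s <#\<^bsub>S\<^esub> K)" using sK by (intro gmono Int_lower1)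
    also have "\<dots> \<le> ln (real (card (\<alpha> s ` traj K X <#> V))) - ln (real (card V))"
    proof -
      have "traj (s <#\<^bsub>S\<^esub> K) X <#> V \<subseteq> \<alpha> s ` traj K X <#> V"
        using traj_translate_subset[OF K sS X(1)] unfolding set_mult_def by blast
      then show ?thesis
        using sg[OF sK] sg[OF K] V unfolding g_def
        by (intro diff_mono mono mult_subgroups finite_set_mult) auto
    qed
    also have "\<dots> \<le> ln (real (card (traj K X))) - ln (real (card Y))"
      using sS sg[OF K] V Y YV[OF s] by (intro ln_card_image_set_mult_le)
    finally show ?thesis .
  qed
  have single: "g {x} \<le> ln (real (card X))" if x: "x \<in> carrier S" for x
  proof -
    have "card (\<alpha> x ` X <#> V) \<le> card (\<alpha> x ` X) * card V"
      using X V by (intro card_set_mult_le) auto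
    also have "\<dots> \<le> card X * card V" using X by (intro mult_le_mono1 card_image_le)
    finally have "real (card (\<alpha> x ` X <#> V)) \<le> real (card X * card V)" by (simp only: of_nat_le_iff)
    moreover have "card (\<alpha> x ` X <#> V) > 0"
      using X V x by (intro card_pos_subgroup[where G = A] mult_subgroups act_subgroup finite_set_mult) auto
    moreover have pos: "card X > 0" "card V > 0" using X V card_pos_subgroup by auto
    ultimately have "ln (real (card (\<alpha> x ` X <#> V))) \<le> ln (real (card X * card V))"
      by (subst ln_le_cancel_iff) auto
    also have "ln (real (card X * card V)) = ln (real (card X)) + ln (real (card V))"
      using pos by (simp only: of_nat_mult ln_mult_pos of_nat_0_less_iff)
    finally show ?thesis using x X by (simp add: g_def traj_singleton)
  qed
  have "card K * g F \<le> (\<Sum>s\<in>F. g ((s <#\<^bsub>S\<^esub> K) \<inter> F))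
      + ln (real (card X)) * (\<Sum>x\<in>F. real (card K) - real (card {s \<in> F. x \<in> s <#\<^bsub>S\<^esub> K}))"
  proof (rule submodular_cover[where C = "carrier S"])
    show "g (E \<union> D) + g (E \<inter> D) \<le> g E + g D"
      if "finite E" "finite D" "E \<subseteq> carrier S" "D \<subseteq> carrier S" for E D
      unfolding g_def using X V that by (rule ln_traj_submodular)
    have "{\<one>} <#> V = V"
      using lcos_mult_one[OF subgroup.subset[OF V(1)]] by (simp add: l_coset_eq_set_mult)
    then show "g {} = 0" by (simp add: g_def trajectory_empty)
    show "card {s \<in> F. x \<in> s <#\<^bsub>S\<^esub> K} \<le> card K" if "x \<in> F" for x
      using S.cover_multiplicity[OF F(1) K(1) F(2) K(2)] K(1) by (simp add: card_mono)
    show "g {x} \<le> ln (real (card X))" if "x \<in> F" for x using that F(2) by (intro single) auto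
  qed (use F in auto)
  also have "\<dots> \<le> card F * (ln (real (card (traj K X))) - ln (real (card Y)))
      + ln (real (card X)) * (\<Sum>t\<in>K. real (card ((F #>\<^bsub>S\<^esub> t) - F)))"
    using sum_mono[of F, OF tr] S.cover_deficiency[OF F(1) K(1) F(2) K(2)] by simp
  finally have "card K * g F \<le> card F * (ln (real (card (traj K X))) - ln (real (card Y)))
      + ln (real (card X)) * (\<Sum>t\<in>K. real (card ((F #>\<^bsub>S\<^esub> t) - F)))" .
  \<comment> \<open>\<open>traj F X\<close> lies in \<open>traj F X <#> V\<close>, so the index
    modulo \<open>V\<close> may be replaced by the plain quotient of cardinalities.\<close>
  moreover have "ln (real (card (traj F X))) - ln (real (card V)) \<le> g F"
    unfolding g_def using sg[OF F] V
    by (intro diff_mono mono finite_set_mult subgroup_le_set_mult) auto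
  then have "card K * (ln (real (card (traj F X))) - ln (real (card V))) \<le> card K * g F"
    by (intro mult_left_mono) auto
  ultimately show ?thesis by linarith
qed

end

subsection \<open>Entropy as an infimum\<close>

lemma net_filter_neq_bot:
  assumes "directed_set I leq"
  shows "net_filter I leq \<noteq> bot"
proof -
  have "\<forall>i\<in>I. leq i i" "I \<noteq> {}" using assms by (simp_all add: directed_set_def)
  then have "\<not> eventually (\<lambda>_. False) (net_filter I leq)"
    unfolding eventually_net_filter[OF assms] by blast
  then show ?thesis by (simp add: trivial_limit_def)
qed

lemma eventually_in_net:
  assumes "directed_set I leq"
  shows "eventually (\<lambda>i. i \<in> I) (net_filter I leq)"
proof -
  have "I \<noteq> {}" using assms by (simp add: directed_set_def)
  then show ?thesis unfolding eventually_net_filter[OF assms] by blast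
qed

text \<open>Net-free form of the entropy of \<open>X\<close>. The empty set must be excluded: its
  rate is 0 / 0 = 0 in HOL, which would force the infimum to be 0 for every finite subgroup.\<close>

definition inf_rate ::
  "('s, 'm) monoid_scheme \<Rightarrow> ('a, 'n) monoid_scheme \<Rightarrow> ('s \<Rightarrow> 'a \<Rightarrow> 'a) \<Rightarrow> 'a set \<Rightarrow> real" where
  "inf_rate S A \<alpha> X = (INF K\<in>{K. finite K \<and> K \<noteq> {} \<and> K \<subseteq> carrier S}. traj_rate A \<alpha> X K)"

section \<open>Convergence of the rates to their infimum\<close>

context cancel_monoid_action
begin

lemma traj_rate_nonneg:
  assumes "subgroup X A" "finite X" "finite K" "K \<subseteq> carrier S"
  shows "0 \<le> traj_rate A \<alpha> X K"
proof -
  have "card (traj K X) > 0"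
    using assms by (intro card_pos_subgroup[where G = A] traj_subgroup traj_finite subgroup.subset[where G = A])
  then show ?thesis by (simp add: traj_rate_def)
qed

lemma inf_rate_le:
  assumes "subgroup X A" "finite X" "finite K" "K \<noteq> {}" "K \<subseteq> carrier S"
  shows "inf_rate S A \<alpha> X \<le> traj_rate A \<alpha> X K"
  unfolding inf_rate_def
proof (rule cINF_lower)
  show "bdd_below (traj_rate A \<alpha> X ` {K. finite K \<and> K \<noteq> {} \<and> K \<subseteq> carrier S})"
    by (rule bdd_belowI2[where m = 0]) (simp add: traj_rate_nonneg[OF assms(1,2)])
qed (use assms(3-5) in simp)

lemma inf_rate_greatest:
  assumes "\<And>K. finite K \<Longrightarrow> K \<noteq> {} \<Longrightarrow> K \<subseteq> carrier S \<Longrightarrow> c \<le> traj_rate A \<alpha> X K"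
  shows "c \<le> inf_rate S A \<alpha> X"
proof -
  have "{\<one>\<^bsub>S\<^esub>} \<in> {K. finite K \<and> K \<noteq> {} \<and> K \<subseteq> carrier S}" by simp
  then show ?thesis unfolding inf_rate_def by (intro cINF_greatest) (blast, simp add: assms)
qed

lemma inf_rate_approx:
  assumes "inf_rate S A \<alpha> X < c"
  shows "\<exists>K. finite K \<and> K \<noteq> {} \<and> K \<subseteq> carrier S \<and> traj_rate A \<alpha> X K < c"
proof (rule ccontr)
  assume neg: "\<not> ?thesis"
  have "c \<le> inf_rate S A \<alpha> X"
  proof (rule inf_rate_greatest)
    show "c \<le> traj_rate A \<alpha> X K" if "finite K" "K \<noteq> {}" "K \<subseteq> carrier S" for K
      using neg that by (auto simp: not_less)
  qed
  with assms show False by simp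
qed

text \<open>This is \<open>ln_traj_cover\<close> divided by |K| |F|, which brings the Folner ratios
  into the error term.\<close>

lemma traj_rate_cover:
  assumes X: "subgroup X A" "finite X" and V: "subgroup V A" "finite V"
    and K: "finite K" "K \<noteq> {}" "K \<subseteq> carrier S" and F: "finite F" "F \<noteq> {}" "F \<subseteq> carrier S"
    and Y: "subgroup Y A" "Y \<subseteq> traj K X" and YV: "\<And>s. s \<in> F \<Longrightarrow> \<alpha> s ` Y \<subseteq> V"
  shows "traj_rate A \<alpha> X F \<le> ln (real (card V)) / real (card F)
      + (ln (real (card (traj K X))) - ln (real (card Y))) / real (card K)
      + ln (real (card X)) / real (card K) * (\<Sum>t\<in>K. real (card ((F #>\<^bsub>S\<^esub> t) - F)) / real (card F))"
proof -
  have pos: "real (card K) > 0" "real (card F) > 0" using K F by (simp_all add: card_gt_0_iff)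
  let ?d = "\<Sum>t\<in>K. real (card ((F #>\<^bsub>S\<^esub> t) - F))"
  let ?r = "ln (real (card (traj K X))) - ln (real (card Y))"
  have "card K * (ln (real (card (traj F X))) - ln (real (card V))) \<le> card F * ?r + ln (real (card X)) * ?d"
    using X V K(1,3) F(1,3) Y YV by (rule ln_traj_cover)
  then have "(card K * (ln (real (card (traj F X))) - ln (real (card V)))) / (real (card K) * real (card F))
      \<le> (card F * ?r + ln (real (card X)) * ?d) / (real (card K) * real (card F))"
    using pos by (intro divide_right_mono) auto
  then have "ln (real (card (traj F X))) / real (card F) - ln (real (card V)) / real (card F)
      \<le> ?r / real (card K) + ln (real (card X)) / real (card K) * (?d / real (card F))"
    using pos by (simp add: add_divide_distrib diff_divide_distrib)
  then show ?thesis by (simp add: traj_rate_def sum_divide_distrib)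
qed

text \<open>The case of trivial \<open>Y\<close> and \<open>V\<close> compares an arbitrary
  \<open>F\<close> with a fixed \<open>K\<close>; only the error term depends on how invariant
  \<open>F\<close> is.\<close>

lemma traj_rate_le_traj_rate:
  assumes X: "subgroup X A" "finite X"
    and K: "finite K" "K \<noteq> {}" "K \<subseteq> carrier S" and F: "finite F" "F \<noteq> {}" "F \<subseteq> carrier S"
  shows "traj_rate A \<alpha> X F \<le> traj_rate A \<alpha> X K
      + ln (real (card X)) / real (card K) * (\<Sum>t\<in>K. real (card ((F #>\<^bsub>S\<^esub> t) - F)) / real (card F))"
proof -
  have "\<alpha> s ` {\<one>} \<subseteq> {\<one>}" if "s \<in> F" for s
    using group_hom.hom_one[OF act_hom] that F by auto
  moreover have "{\<one>} \<subseteq> traj K X"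
    using subgroup.one_closed[OF traj_subgroup[OF K(1,3) X(1)]] by simp
  ultimately show ?thesis
    using traj_rate_cover[OF X triv_subgroup _ K F triv_subgroup] by (simp add: traj_rate_def)
qed

lemma deficiency_tendsto_0:
  assumes net: "right_Folner_net S I leq F" and K: "finite K" "K \<subseteq> carrier S"
  shows "((\<lambda>i. c * (\<Sum>t\<in>K. real (card ((F i #>\<^bsub>S\<^esub> t) - F i)) / real (card (F i)))) \<longlongrightarrow> 0) (net_filter I leq)"
proof -
  have "((\<lambda>i. \<Sum>t\<in>K. real (card ((F i #>\<^bsub>S\<^esub> t) - F i)) / real (card (F i))) \<longlongrightarrow> (\<Sum>t\<in>K. 0)) (net_filter I leq)"
    using net K by (intro tendsto_sum) (auto simp: right_Folner_net_def)
  from tendsto_mult_left[OF this, of c] show ?thesis by simp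
qed

text \<open>The rates never drop below the infimum, as each \<open>F i\<close> takes part in it.
  From above they are compared with an almost optimal fixed \<open>K\<close>, whose error term
  vanishes along the net.\<close>

lemma traj_rate_tendsto:
  assumes X: "subgroup X A" "finite X" and net: "right_Folner_net S I leq F"
  shows "((\<lambda>i. traj_rate A \<alpha> X (F i)) \<longlongrightarrow> inf_rate S A \<alpha> X) (net_filter I leq)"
proof (rule order_tendstoI)
  have dir: "directed_set I leq" and F: "\<And>i. i \<in> I \<Longrightarrow> F i \<subseteq> carrier S \<and> finite (F i) \<and> F i \<noteq> {}"
    using net by (auto simp: right_Folner_net_def)
  note inI = eventually_in_net[OF dir]
  show "eventually (\<lambda>i. a < traj_rate A \<alpha> X (F i)) (net_filter I leq)" if "a < inf_rate S A \<alpha> X" for a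
    using inI
  proof eventually_elim
    case (elim i)
    with inf_rate_le[OF X, of "F i"] F that show ?case by fastforce
  qed
  show "eventually (\<lambda>i. traj_rate A \<alpha> X (F i) < a) (net_filter I leq)" if a: "inf_rate S A \<alpha> X < a" for a
  proof -
    obtain K where K: "finite K" "K \<noteq> {}" "K \<subseteq> carrier S" "traj_rate A \<alpha> X K < a"
      using inf_rate_approx[OF a] by blast
    let ?d = "\<lambda>i. ln (real (card X)) / real (card K) *
      (\<Sum>t\<in>K. real (card ((F i #>\<^bsub>S\<^esub> t) - F i)) / real (card (F i)))"
    have "eventually (\<lambda>i. ?d i < a - traj_rate A \<alpha> X K) (net_filter I leq)"
      by (rule order_tendstoD(2)[OF deficiency_tendsto_0[OF net K(1,3)]]) (use K(4) in simp)
    with inI show ?thesis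
    proof eventually_elim
      case (elim i)
      with traj_rate_le_traj_rate[OF X K(1-3), of "F i"] F show ?case by fastforce
    qed
  qed
qed

lemma H_alg_eq_inf_rate:
  assumes am: "right_amenable S" and X: "subgroup X A" "finite X"
  shows "H_alg S A \<alpha> X = inf_rate S A \<alpha> X"
  unfolding H_alg_def
proof (rule the_equality)
  show "\<forall>(I :: ('s set set \<times> 's set) set) leq F. right_Folner_net S I leq F \<longrightarrow>
      ((\<lambda>i. traj_rate A \<alpha> X (F i)) \<longlongrightarrow> inf_rate S A \<alpha> X) (net_filter I leq)"
    using traj_rate_tendsto[OF X] by blast
next
  fix h
  assume h: "\<forall>(I :: ('s set set \<times> 's set) set) leq F. right_Folner_net S I leq F \<longrightarrow>
      ((\<lambda>i. traj_rate A \<alpha> X (F i)) \<longlongrightarrow> h) (net_filter I leq)"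
  \<comment> \<open>Amenability enters for uniqueness: any candidate \<open>h\<close> must agree
    with the infimum along one actual net. The index type of that net is not the one in
    \<open>H_alg\<close>, hence the transfer by \<open>tendsto_any_right_Folner_net\<close>.\<close>
  note net = S.right_Folner_net_exists[OF am]
  from net have "directed_set {p :: 's set \<times> nat. finite (fst p) \<and> fst p \<subseteq> carrier S}
      (\<lambda>p q. fst p \<subseteq> fst q \<and> snd p \<le> snd q)"
    by (simp add: right_Folner_net_def)
  note nb = net_filter_neq_bot[OF this]
  show "h = inf_rate S A \<alpha> X"
  proof (rule tendsto_unique[OF nb _ traj_rate_tendsto[OF X net]])
    show "((\<lambda>p. traj_rate A \<alpha> X (Folner_choice S p)) \<longlongrightarrow> h)
        (net_filter {p. finite (fst p) \<and> fst p \<subseteq> carrier S} (\<lambda>p q. fst p \<subseteq> fst q \<and> snd p \<le> snd q))"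
      by (rule tendsto_any_right_Folner_net[OF _ net]) (rule h[rule_format])
  qed
qed

end

subsection \<open>Invariant subgroups and quotients\<close>

lemma (in group_hom) image_set_mult:
  assumes "P \<subseteq> carrier G" "R \<subseteq> carrier G"
  shows "h ` (P <#> R) = h ` P <#>\<^bsub>H\<^esub> h ` R"
proof -
  have "h (x \<otimes> y) = h x \<otimes>\<^bsub>H\<^esub> h y" if "x \<in> P" "y \<in> R" for x y
    using that assms by (intro hom_mult) auto
  then show ?thesis unfolding set_mult_def by (simp add: image_UN)
qed

lemma (in comm_group) subgroup_comm_group:
  assumes "subgroup B G"
  shows "comm_group (G\<lparr>carrier := B\<rparr>)"
proof -
  interpret B: group "G\<lparr>carrier := B\<rparr>" using assms by (rule subgroup_imp_group)
  show ?thesis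
    using subgroup.subset[OF assms] by (intro B.group_comm_groupI) (auto simp: m_comm subset_iff)
qed

locale cancel_monoid_action_invariant = cancel_monoid_action S A \<alpha>
  for S :: "('s, 'm) monoid_scheme" and A :: "('a, 'n) monoid_scheme" (structure)
    and \<alpha> :: "'s \<Rightarrow> 'a \<Rightarrow> 'a" +
  fixes B :: "'a set"
  assumes invariant: "invariant_subgroup S A \<alpha> B"
begin

lemma B_subgroup: "subgroup B A"
  using invariant by (simp add: invariant_subgroup_def)

lemma B_inv: "s \<in> carrier S \<Longrightarrow> \<alpha> s ` B \<subseteq> B"
  using invariant by (simp add: invariant_subgroup_def)

lemma B_subset: "B \<subseteq> carrier A"
  using B_subgroup by (rule subgroup.subset)

sublocale B: cancel_monoid_action S "A\<lparr>carrier := B\<rparr>" "restr_action \<alpha> B"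
proof (intro cancel_monoid_action.intro cancel_monoid_action_axioms.intro subgroup_comm_group B_subgroup)
  show "left_action S (A\<lparr>carrier := B\<rparr>) (restr_action \<alpha> B)"
    unfolding left_action_def
  proof (intro conjI ballI)
    have cl: "\<alpha> s a \<in> B" if "s \<in> carrier S" "a \<in> B" for s a using B_inv that by blast
    have BA: "a \<in> carrier A" if "a \<in> B" for a using B_subset that by blast
    show "restr_action \<alpha> B s \<in> hom (A\<lparr>carrier := B\<rparr>) (A\<lparr>carrier := B\<rparr>)" if s: "s \<in> carrier S" for s
      using s by (intro homI)
        (simp_all add: restr_action_def cl BA group_hom.hom_mult[OF act_hom[OF s]]
          subgroup.m_closed[OF B_subgroup])
    show "restr_action \<alpha> B (s \<otimes>\<^bsub>S\<^esub> t) a = restr_action \<alpha> B s (restr_action \<alpha> B t a)"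
      if "s \<in> carrier S" "t \<in> carrier S" "a \<in> carrier (A\<lparr>carrier := B\<rparr>)" for s t a
      using that by (simp add: restr_action_def cl BA act_mult)
    show "restr_action \<alpha> B \<one>\<^bsub>S\<^esub> a = a" if "a \<in> carrier (A\<lparr>carrier := B\<rparr>)" for a
      using that BA act_one by (simp add: restr_action_def)
  qed
qed (rule S.monoid_cancel_axioms)

abbreviation \<pi> :: "'a \<Rightarrow> 'a set" where
  "\<pi> \<equiv> \<lambda>a. B #> a"

lemma quot_act: "s \<in> carrier S \<Longrightarrow> a \<in> carrier A \<Longrightarrow> quot_action A \<alpha> B s (\<pi> a) = \<pi> (\<alpha> s a)"
  using quot_action_coset[OF comm_group_axioms action invariant] .

sublocale \<pi>: group_hom A "A Mod B" \<pi>
  using B_subgroup by (rule group_hom_Mod)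

sublocale Q: cancel_monoid_action S "A Mod B" "quot_action A \<alpha> B"
proof (intro cancel_monoid_action.intro cancel_monoid_action_axioms.intro abelian_FactGroup B_subgroup)
  have cl: "\<alpha> s a \<in> carrier A" if "s \<in> carrier S" "a \<in> carrier A" for s a
    using group_hom.hom_closed[OF act_hom] that by blast
  show "left_action S (A Mod B) (quot_action A \<alpha> B)"
    unfolding left_action_def
  proof (intro conjI ballI)
    show "quot_action A \<alpha> B s \<in> hom (A Mod B) (A Mod B)" if s: "s \<in> carrier S" for s
    proof (rule homI)
      fix x assume "x \<in> carrier (A Mod B)"
      then obtain a where a: "a \<in> carrier A" "x = \<pi> a" by (auto simp: carrier_FactGroup)
      then show "quot_action A \<alpha> B s x \<in> carrier (A Mod B)"
        using s cl by (simp add: quot_act carrier_FactGroup)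
      fix y assume "y \<in> carrier (A Mod B)"
      then obtain b where b: "b \<in> carrier A" "y = \<pi> b" by (auto simp: carrier_FactGroup)
      show "quot_action A \<alpha> B s (x \<otimes>\<^bsub>A Mod B\<^esub> y)
          = quot_action A \<alpha> B s x \<otimes>\<^bsub>A Mod B\<^esub> quot_action A \<alpha> B s y"
      proof -
        have "quot_action A \<alpha> B s (\<pi> a \<otimes>\<^bsub>A Mod B\<^esub> \<pi> b) = quot_action A \<alpha> B s (\<pi> (a \<otimes> b))"
          by (simp only: \<pi>.hom_mult[OF a(1) b(1)])
        also have "\<dots> = \<pi> (\<alpha> s a \<otimes> \<alpha> s b)"
          using group_hom.hom_mult[OF act_hom[OF s] a(1) b(1)] quot_act[OF s m_closed[OF a(1) b(1)]] by simp
        also have "\<dots> = \<pi> (\<alpha> s a) \<otimes>\<^bsub>A Mod B\<^esub> \<pi> (\<alpha> s b)"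
          using cl[OF s a(1)] cl[OF s b(1)] by (rule \<pi>.hom_mult)
        finally show ?thesis
          by (simp only: a(2) b(2) quot_act[OF s a(1)] quot_act[OF s b(1)])
      qed
    qed
    show "quot_action A \<alpha> B (s \<otimes>\<^bsub>S\<^esub> t) a = quot_action A \<alpha> B s (quot_action A \<alpha> B t a)"
      if st: "s \<in> carrier S" "t \<in> carrier S" and "a \<in> carrier (A Mod B)" for s t a
    proof -
      from that obtain c where c: "c \<in> carrier A" "a = \<pi> c" by (auto simp: carrier_FactGroup)
      show ?thesis
        unfolding c(2) using st c(1) cl by (simp only: quot_act act_mult S.m_closed)
    qed
    show "quot_action A \<alpha> B \<one>\<^bsub>S\<^esub> a = a" if "a \<in> carrier (A Mod B)" for a
      using that act_one by (auto simp: carrier_FactGroup quot_act)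
  qed
qed (rule S.monoid_cancel_axioms)

lemma traj_restr:
  assumes "finite F" "F \<subseteq> carrier S" "Y \<subseteq> B"
  shows "B.traj F Y = traj F Y"
  using assms(1,2)
proof (induction F rule: finite_induct)
  case empty
  show ?case by (simp add: trajectory_empty B.trajectory_empty)
next
  case (insert s F)
  have "restr_action \<alpha> B s ` Y = \<alpha> s ` Y" using assms(3) by (auto simp: restr_action_def)
  then show ?case
    using insert assms(3) B_subset by (simp add: traj_insert B.traj_insert set_mult_def)
qed

lemma traj_quot:
  assumes "finite F" "F \<subseteq> carrier S" "X \<subseteq> carrier A"
  shows "Q.traj F (\<pi> ` X) = \<pi> ` traj F X"
  using assms(1,2)
proof (induction F rule: finite_induct)
  case empty
  show ?case using B_subset by (simp add: trajectory_empty Q.trajectory_empty)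
next
  case (insert s F)
  have c: "traj F X \<subseteq> carrier A"
  proof (rule traj_least[OF insert.hyps(1) _ assms(3) subgroup_self])
    show "\<alpha> t ` X \<subseteq> carrier A" if "t \<in> F" for t
      using act_subset[OF _ assms(3)] insert.prems that by blast
  qed (use insert.prems in simp)
  have s: "s \<in> carrier S" using insert.prems by simp
  have im: "\<alpha> s ` X \<subseteq> carrier A" using act_subset[OF s assms(3)] .
  have "quot_action A \<alpha> B s ` \<pi> ` X = \<pi> ` \<alpha> s ` X"
    unfolding image_image using assms(3) s quot_act by (intro image_cong) auto
  moreover have "\<pi> ` X \<subseteq> carrier (A Mod B)" using assms(3) by (auto simp: carrier_FactGroup)
  ultimately show ?case
    using insert assms(3) c im by (simp add: traj_insert Q.traj_insert \<pi>.image_set_mult)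
qed

text \<open>Lagrange for \<open>traj K X\<close> modulo \<open>B\<close>, where projecting commutes
  with forming trajectories. The subgroup \<open>traj K X \<inter> B\<close> need not be a
  trajectory in \<open>B\<close>, which is why only one of the two inequalities follows
  directly.\<close>

lemma ln_card_traj_eq:
  assumes "subgroup X A" "finite X" "finite K" "K \<subseteq> carrier S"
  shows "ln (real (card (traj K X))) = ln (real (card (Q.traj K (\<pi> ` X)))) + ln (real (card (traj K X \<inter> B)))"
proof -
  have X: "X \<subseteq> carrier A" using assms(1) by (rule subgroup.subset)
  have T: "subgroup (traj K X) A" using assms(3,4,1) by (rule traj_subgroup)
  have fT: "finite (traj K X)" using assms(3,4) X assms(2) by (rule traj_finite)
  have "card (traj K X) = card (Q.traj K (\<pi> ` X)) * card (traj K X \<inter> B)"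
    unfolding traj_quot[OF assms(3,4) X] using B_subgroup T fT by (rule card_subgroup_eq_card_cosets_mult)
  moreover have "card (traj K X) > 0" using T fT by (rule card_pos_subgroup)
  ultimately show ?thesis by (metis ln_mult_pos nat_0_less_mult_iff of_nat_0_less_iff of_nat_mult)
qed

text \<open>For one and the same \<open>K\<close>, the trajectories of \<open>Y\<close> and
  \<open>Z\<close> lie in the two factors of \<open>ln_card_traj_eq\<close>; the sum of the infima
  is at most the sum of the rates at \<open>K\<close>.\<close>

lemma inf_rate_add_le:
  assumes X: "subgroup X A" "finite X" and Y: "subgroup Y (A\<lparr>carrier := B\<rparr>)" "Y \<subseteq> X"
    and Z: "subgroup Z (A Mod B)" "Z \<subseteq> \<pi> ` X"
  shows "inf_rate S (A\<lparr>carrier := B\<rparr>) (restr_action \<alpha> B) Y + inf_rate S (A Mod B) (quot_action A \<alpha> B) Z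
    \<le> inf_rate S A \<alpha> X"
proof (rule inf_rate_greatest)
  fix K assume K: "finite K" "K \<noteq> {}" "K \<subseteq> carrier S"
  have fin: "finite Y" "finite Z"
    using finite_subset[OF Y(2)] finite_subset[OF Z(2)] X(2) by simp_all
  have YB: "Y \<subseteq> B" using subgroup.subset[OF Y(1)] by simp
  have XA: "X \<subseteq> carrier A" using X(1) by (rule subgroup.subset)
  have fT: "finite (traj K X)" using K X XA by (intro traj_finite)
  have \<pi>X: "subgroup (\<pi> ` X) (A Mod B)" using X(1) by (rule \<pi>.subgroup_img_is_subgroup)
  have "B.traj K Y \<subseteq> B"
    using subgroup.subset[OF B.traj_subgroup[OF K(1,3) Y(1)]] by simp
  then have "B.traj K Y \<subseteq> traj K X \<inter> B"
    using traj_restr[OF K(1,3) YB] traj_mono[OF K(1,3) X(1) order_refl Y(2)] by simp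
  then have "card (B.traj K Y) \<le> card (traj K X \<inter> B)" using fT by (intro card_mono) auto
  moreover have "card (B.traj K Y) > 0"
    using K Y fin by (intro card_pos_subgroup[where G = "A\<lparr>carrier := B\<rparr>"] B.traj_subgroup B.traj_finite
        subgroup.subset[where G = "A\<lparr>carrier := B\<rparr>"])
  ultimately have 1: "ln (real (card (B.traj K Y))) \<le> ln (real (card (traj K X \<inter> B)))"
    by (subst ln_le_cancel_iff) auto
  have "card (Q.traj K Z) \<le> card (Q.traj K (\<pi> ` X))"
    using K X \<pi>X Z by (intro card_mono Q.traj_finite Q.traj_mono subgroup.subset[OF \<pi>X]) auto
  moreover have "card (Q.traj K Z) > 0"
    using K Z fin by (intro card_pos_subgroup[where G = "A Mod B"] Q.traj_subgroup Q.traj_finite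
        subgroup.subset[where G = "A Mod B"])
  ultimately have 2: "ln (real (card (Q.traj K Z))) \<le> ln (real (card (Q.traj K (\<pi> ` X))))"
    by (subst ln_le_cancel_iff) auto
  have "inf_rate S (A\<lparr>carrier := B\<rparr>) (restr_action \<alpha> B) Y + inf_rate S (A Mod B) (quot_action A \<alpha> B) Z
      \<le> traj_rate (A\<lparr>carrier := B\<rparr>) (restr_action \<alpha> B) Y K + traj_rate (A Mod B) (quot_action A \<alpha> B) Z K"
    using K Y Z fin by (intro add_mono B.inf_rate_le Q.inf_rate_le)
  also have "\<dots> = (ln (real (card (B.traj K Y))) + ln (real (card (Q.traj K Z)))) / real (card K)"
    by (simp add: traj_rate_def add_divide_distrib)
  also have "\<dots> \<le> ln (real (card (traj K X))) / real (card K)"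
    using 1 2 ln_card_traj_eq[OF X K(1,3)] by (intro divide_right_mono) auto
  finally show "inf_rate S (A\<lparr>carrier := B\<rparr>) (restr_action \<alpha> B) Y + inf_rate S (A Mod B) (quot_action A \<alpha> B) Z
      \<le> traj_rate A \<alpha> X K" by (simp add: traj_rate_def)
qed

text \<open>For \<open>Y = T\<^sub>K(X) \<inter> B\<close> the covering inequality modulo \<open>T\<^sub>F(Y)\<close> bounds \<open>|T\<^sub>F(X) / T\<^sub>F(Y)|\<close>
  by the growth of \<open>\<pi> X\<close> along \<open>K\<close>.\<close>

lemma inf_rate_le_add:
  assumes am: "right_amenable S" and X: "subgroup X A" "finite X" and e: "e > 0"
  obtains Y where "subgroup Y (A\<lparr>carrier := B\<rparr>)" "finite Y"
    "inf_rate S A \<alpha> X \<le> inf_rate S (A\<lparr>carrier := B\<rparr>) (restr_action \<alpha> B) Y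
      + inf_rate S (A Mod B) (quot_action A \<alpha> B) (\<pi> ` X) + e"
proof -
  let ?q = "inf_rate S (A Mod B) (quot_action A \<alpha> B) (\<pi> ` X)"
  have \<pi>X: "subgroup (\<pi> ` X) (A Mod B)" "finite (\<pi> ` X)" using \<pi>.subgroup_img_is_subgroup X by auto
  obtain K where K: "finite K" "K \<noteq> {}" "K \<subseteq> carrier S"
    and Kq: "traj_rate (A Mod B) (quot_action A \<alpha> B) (\<pi> ` X) K < ?q + e"
    using Q.inf_rate_approx[of "\<pi> ` X" "?q + e"] e by auto
  define Y where "Y = traj K X \<inter> B"
  have T: "subgroup (traj K X) A" "finite (traj K X)"
    using K X by (auto intro!: traj_subgroup traj_finite subgroup.subset[where G = A])
  have YA: "subgroup Y A" unfolding Y_def using T(1) B_subgroup by (rule subgroups_Inter_pair)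
  have Y: "subgroup Y (A\<lparr>carrier := B\<rparr>)" "finite Y" "Y \<subseteq> B"
    using subgroup_incl[OF YA B_subgroup] T by (auto simp: Y_def)
  let ?h = "inf_rate S (A\<lparr>carrier := B\<rparr>) (restr_action \<alpha> B) Y"
  let ?I = "{p :: 's set \<times> nat. finite (fst p) \<and> fst p \<subseteq> carrier S}"
  let ?leq = "\<lambda>p q :: 's set \<times> nat. fst p \<subseteq> fst q \<and> snd p \<le> snd q"
  let ?F = "Folner_choice S"
  let ?d = "\<lambda>p. ln (real (card X)) / real (card K) *
      (\<Sum>t\<in>K. real (card ((?F p #>\<^bsub>S\<^esub> t) - ?F p)) / real (card (?F p)))"
  note net = S.right_Folner_net_exists[OF am]
  then have dir: "directed_set ?I ?leq" by (simp add: right_Folner_net_def)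
  have Fp: "\<forall>p\<in>?I. ?F p \<subseteq> carrier S \<and> finite (?F p) \<and> ?F p \<noteq> {}"
    using net unfolding right_Folner_net_def by (elim conjE)
  have "eventually (\<lambda>p. traj_rate A \<alpha> X (?F p)
      \<le> traj_rate (A\<lparr>carrier := B\<rparr>) (restr_action \<alpha> B) Y (?F p) + (?q + e) + ?d p) (net_filter ?I ?leq)"
    using eventually_in_net[OF dir]
  proof eventually_elim
    case (elim p)
    with Fp have F: "finite (?F p)" "?F p \<noteq> {}" "?F p \<subseteq> carrier S" by blast+
    \<comment> \<open>\<open>?V\<close> varies with \<open>p\<close>: it is the smallest subgroup
      into which all of \<open>?F p\<close> maps \<open>Y\<close>, and its logarithm over |F| is the
      rate of \<open>Y\<close> in \<open>B\<close>.\<close>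
    let ?V = "traj (?F p) Y"
    have V: "subgroup ?V A" "finite ?V"
      using traj_subgroup[OF F(1,3) YA] traj_finite[OF F(1,3) subgroup.subset[OF YA] Y(2)] by simp_all
    have "traj_rate A \<alpha> X (?F p) \<le> ln (real (card ?V)) / real (card (?F p))
        + (ln (real (card (traj K X))) - ln (real (card Y))) / real (card K) + ?d p"
      using traj_upper[OF F(1,3) YA] by (intro traj_rate_cover[OF X V K F YA]) (simp_all add: Y_def)
    \<comment> \<open>As \<open>Y\<close> is all of \<open>traj K X \<inter> B\<close>, dividing it
      out leaves exactly the trajectory of the projection of \<open>X\<close>.\<close>
    moreover have "(ln (real (card (traj K X))) - ln (real (card Y))) / real (card K) < ?q + e"
      using Kq ln_card_traj_eq[OF X K(1,3)] by (simp add: Y_def traj_rate_def)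
    ultimately show ?case
      using traj_restr[OF F(1,3) Y(3)] by (simp add: traj_rate_def)
  qed
  \<comment> \<open>\<open>K\<close> and \<open>Y\<close> stay fixed while \<open>p\<close> grows,
    so the bound converges term by term.\<close>
  moreover have "((\<lambda>p. traj_rate (A\<lparr>carrier := B\<rparr>) (restr_action \<alpha> B) Y (?F p) + (?q + e) + ?d p)
      \<longlongrightarrow> ?h + (?q + e) + 0) (net_filter ?I ?leq)"
    using deficiency_tendsto_0[OF net K(1,3)] B.traj_rate_tendsto[OF Y(1,2) net]
    by (intro tendsto_add tendsto_const)
  ultimately have "inf_rate S A \<alpha> X \<le> ?h + (?q + e) + 0"
    by (rule tendsto_le[OF net_filter_neq_bot[OF dir] _ traj_rate_tendsto[OF X net], rotated])
  then have "inf_rate S A \<alpha> X \<le> ?h + ?q + e" by linarith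
  then show ?thesis by (rule that[OF Y(1,2)])
qed

end

section \<open>Both inequalities passed to the suprema over finite subgroups\<close>

theorem theorem1p1:
  fixes S :: "('s, 'm) monoid_scheme"
    and A :: "('a, 'n) monoid_scheme"
    and \<alpha> :: "'s \<Rightarrow> 'a \<Rightarrow> 'a"
    and B :: "'a set"
  assumes "monoid_cancel S" and "right_amenable S"
    and "comm_group A" and "torsion_group A"
    and "left_action S A \<alpha>"
    and "invariant_subgroup S A \<alpha> B"
  shows "ent S A \<alpha> =
    ent S (A\<lparr>carrier := B\<rparr>) (restr_action \<alpha> B) + ent S (A Mod B) (quot_action A \<alpha> B)"
proof -
  interpret cancel_monoid_action_invariant S A \<alpha> B
    using assms by (intro cancel_monoid_action_invariant.intro cancel_monoid_action.intro
        cancel_monoid_action_axioms.intro cancel_monoid_action_invariant_axioms.intro)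
  let ?A = "{X. subgroup X A \<and> finite X}"
  let ?B = "{Y. subgroup Y (A\<lparr>carrier := B\<rparr>) \<and> finite Y}"
  let ?Q = "{Z. subgroup Z (A Mod B) \<and> finite Z}"
  let ?hA = "inf_rate S A \<alpha>"
  let ?hB = "inf_rate S (A\<lparr>carrier := B\<rparr>) (restr_action \<alpha> B)"
  let ?hQ = "inf_rate S (A Mod B) (quot_action A \<alpha> B)"
  have eA: "ent S A \<alpha> = (SUP X\<in>?A. ereal (?hA X))"
    unfolding ent_def using H_alg_eq_inf_rate[OF assms(2)] by (intro SUP_cong) auto
  have eB: "ent S (A\<lparr>carrier := B\<rparr>) (restr_action \<alpha> B) = (SUP Y\<in>?B. ereal (?hB Y))"
    unfolding ent_def using B.H_alg_eq_inf_rate[OF assms(2)] by (intro SUP_cong) auto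
  have eQ: "ent S (A Mod B) (quot_action A \<alpha> B) = (SUP Z\<in>?Q. ereal (?hQ Z))"
    unfolding ent_def using Q.H_alg_eq_inf_rate[OF assms(2)] by (intro SUP_cong) auto
  have neB: "?B \<noteq> {}" using B.triv_subgroup by blast
  have neQ: "?Q \<noteq> {}" using \<pi>.H.triv_subgroup by blast
  show ?thesis
  proof (rule antisym)
    show "ent S A \<alpha> \<le> ent S (A\<lparr>carrier := B\<rparr>) (restr_action \<alpha> B) + ent S (A Mod B) (quot_action A \<alpha> B)"
      unfolding eA
    proof (rule SUP_least)
      fix X assume "X \<in> ?A"
      then have X: "subgroup X A" "finite X" by auto
      then have \<pi>X: "\<pi> ` X \<in> ?Q" using \<pi>.subgroup_img_is_subgroup by auto
      show "ereal (?hA X) \<le> ent S (A\<lparr>carrier := B\<rparr>) (restr_action \<alpha> B) + ent S (A Mod B) (quot_action A \<alpha> B)"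
      proof (rule ereal_le_epsilon2)
        fix d :: real assume d: "0 < d"
        obtain Y where Y: "Y \<in> ?B" "?hA X \<le> ?hB Y + ?hQ (\<pi> ` X) + d"
          using inf_rate_le_add[OF assms(2) X d] by blast
        have "ereal (?hA X) \<le> ereal (?hB Y) + ereal (?hQ (\<pi> ` X)) + ereal d" using Y(2) by simp
        also have "\<dots> \<le> ent S (A\<lparr>carrier := B\<rparr>) (restr_action \<alpha> B) + ent S (A Mod B) (quot_action A \<alpha> B) + ereal d"
          unfolding eB eQ using Y(1) \<pi>X by (intro add_mono SUP_upper order_refl)
        finally show "ereal (?hA X) \<le>
          ent S (A\<lparr>carrier := B\<rparr>) (restr_action \<alpha> B) + ent S (A Mod B) (quot_action A \<alpha> B) + ereal d" .
      qed
    qed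
    have le: "ereal (?hB Y) + ereal (?hQ Z) \<le> ent S A \<alpha>" if "Y \<in> ?B" "Z \<in> ?Q" for Y Z
    proof -
      have Y: "subgroup Y (A\<lparr>carrier := B\<rparr>)" "finite Y" and Z: "subgroup Z (A Mod B)" "finite Z"
        using that by auto
      \<comment> \<open>Lift \<open>Z\<close> to a finite set \<open>U\<close> of representatives.
        Torsion puts \<open>U\<close> and \<open>Y\<close> together into one finite subgroup
        \<open>X\<close> of \<open>A\<close>, which then contains \<open>Y\<close> and projects onto
        a group containing \<open>Z\<close>.\<close>
      have "Z \<subseteq> \<pi> ` carrier A" using subgroup.subset[OF Z(1)] by (simp add: carrier_FactGroup)
      then obtain U where U: "U \<subseteq> carrier A" "finite U" "Z = \<pi> ` U"
        using finite_subset_image[OF Z(2)] by metis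
      have "U \<union> Y \<subseteq> carrier A" using U(1) B_subset subgroup.subset[OF Y(1)] by auto
      then obtain X where X: "subgroup X A" "finite X" "U \<union> Y \<subseteq> X"
        using torsion_finite_subgroup[OF assms(4), of "U \<union> Y"] U(2) Y(2) by auto
      have "?hB Y + ?hQ Z \<le> ?hA X"
        using X U(3) by (intro inf_rate_add_le Y Z) auto
      then have "ereal (?hB Y) + ereal (?hQ Z) \<le> ereal (?hA X)" by simp
      also have "\<dots> \<le> ent S A \<alpha>" unfolding eA using X by (intro SUP_upper) auto
      finally show ?thesis .
    qed
    \<comment> \<open>Moving a constant into a supremum in \<open>ereal\<close> requires that the
      constant is not minus infinity and that the index set is nonempty; \<open>Z0\<close> gives a
      real lower bound.\<close>
    obtain Z0 where "Z0 \<in> ?Q" using neQ by blast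
    then have "ereal (?hQ Z0) \<le> ent S (A Mod B) (quot_action A \<alpha> B)" unfolding eQ by (rule SUP_upper)
    then have "ent S (A Mod B) (quot_action A \<alpha> B) \<noteq> -\<infinity>" by auto
    then have "ent S (A\<lparr>carrier := B\<rparr>) (restr_action \<alpha> B) + ent S (A Mod B) (quot_action A \<alpha> B)
        = (SUP Y\<in>?B. ereal (?hB Y) + ent S (A Mod B) (quot_action A \<alpha> B))"
      unfolding eB by (intro SUP_ereal_add_left[symmetric] neB)
    also have "\<dots> \<le> ent S A \<alpha>"
    proof (rule SUP_least)
      fix Y assume Y: "Y \<in> ?B"
      have "ereal (?hB Y) + ent S (A Mod B) (quot_action A \<alpha> B) = (SUP Z\<in>?Q. ereal (?hB Y) + ereal (?hQ Z))"
        unfolding eQ by (intro SUP_ereal_add_right[symmetric] neQ) simp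
      also have "\<dots> \<le> ent S A \<alpha>" using le[OF Y] by (intro SUP_least)
      finally show "ereal (?hB Y) + ent S (A Mod B) (quot_action A \<alpha> B) \<le> ent S A \<alpha>" .
    qed
    finally show "ent S (A\<lparr>carrier := B\<rparr>) (restr_action \<alpha> B) + ent S (A Mod B) (quot_action A \<alpha> B) \<le> ent S A \<alpha>" .
  qed
qed

end
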